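(* Let $d\ge 1$, let $\vec f:\mathbb{R}\to\mathbb{R}^d$ be a smooth function, and let $(S_t)_{t\ge 0}$ be the Kruzhkov entropy-solution semigroup of $\partial_tu+\mathrm{div}_x\vec f(u)=0$ on $\mathbb{R}^d$. Let $r>0$ and let $$\mathcal{Q}_r:=\Big\{b\in L^\infty(\mathbb{R}^d)\;:\;\int_{\mathbb{R}^d}|b(x)|\,dx\le r\Big\}.$$ If $a\in (L^2\cap L^\infty)(\mathbb{R}^d)$, then the function $t\mapsto d_2(S_ta;\mathcal{Q}_r)$, $t\ge0$, is non-increasing.
   Context: For $a\in L^\infty(\mathbb{R}^d)$, $S_ta=u(t,\cdot)$ denotes the unique bounded entropy solution (Kruzhkov) of $\partial_tu+\mathrm{div}_x\vec f(u)=0$ with $u(0,\cdot)=a$, taken as the representative continuous in time with values in $L^1_{\rm loc}(\mathbb{R}^d)$. That is, $u\in L^\infty$ attains the initial data and for every convex $\eta:\mathbb{R}\to\mathbb{R}$, with $\vec q\,'=\eta'\vec f\,'$, one has $\partial_t\eta(u)+\mathrm{div}_x\vec q(u)\le 0$ in the sense of distributions. The $L^2$-distance is $d_2(v;\mathcal{Q}_r):=\inf_{b\in\mathcal{Q}_r}\|v-b\|_{L^2(\mathbb{R}^d)}$. *)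

theory Defs
  imports "HOL-Analysis.Analysis"
begin

text \<open>
  Elements of \<open>L\<^sup>p\<close> spaces are represented by real-valued Lebesgue measurable functions, not by
  equivalence classes; all notions below are invariant under modification on null sets (for a
  time-dependent function \<open>u\<close>, of each \<open>u t\<close> as long as \<open>u\<close> stays jointly measurable).
\<close>

definition Linf :: "'a measure \<Rightarrow> ('a \<Rightarrow> real) set" where
  "Linf M = {v \<in> borel_measurable M. \<exists>C. AE x in M. \<bar>v x\<bar> \<le> C}"

definition L1loc :: "('a::euclidean_space \<Rightarrow> real) set" where
  "L1loc = {v. \<forall>K. compact K \<longrightarrow> set_integrable lebesgue K v}"

definition L2_norm :: "('a::euclidean_space \<Rightarrow> real) \<Rightarrow> ennreal" where
  "L2_norm v =
    (let I = (\<integral>\<^sup>+ x. ennreal ((v x)\<^sup>2) \<partial>lebesgue)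
     in if I = \<infinity> then \<infinity> else ennreal (sqrt (enn2real I)))"

definition L2 :: "('a::euclidean_space \<Rightarrow> real) set" where
  "L2 = {v \<in> borel_measurable lebesgue. L2_norm v < \<infinity>}"

definition L2_dist :: "('a::euclidean_space \<Rightarrow> real) \<Rightarrow> ('a \<Rightarrow> real) set \<Rightarrow> ennreal" where
  "L2_dist v Q = (INF b\<in>Q. L2_norm (\<lambda>x. v x - b x))"

definition Q_ball :: "real \<Rightarrow> ('a::euclidean_space \<Rightarrow> real) set" where
  "Q_ball r = {b \<in> Linf lebesgue. (\<integral>\<^sup>+ x. ennreal \<bar>b x\<bar> \<partial>lebesgue) \<le> ennreal r}"

text \<open>\<open>C\<^sup>k\<close> on the whole space, through iterated directional derivatives.\<close>

primrec k_smooth :: "nat \<Rightarrow> ('a::real_normed_vector \<Rightarrow> 'b::real_normed_vector) \<Rightarrow> bool" where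
  "k_smooth 0 g \<longleftrightarrow> continuous_on UNIV g"
| "k_smooth (Suc k) g \<longleftrightarrow>
     (\<forall>x. g differentiable (at x)) \<and> (\<forall>v. k_smooth k (\<lambda>x. frechet_derivative g (at x) v))"

definition smooth :: "('a::real_normed_vector \<Rightarrow> 'b::real_normed_vector) \<Rightarrow> bool" where
  "smooth g \<longleftrightarrow> (\<forall>k. k_smooth k g)"

text \<open>
  A convex \<open>\<eta>\<close> is differentiable off a countable set, and where it is differentiable \<open>\<eta>'\<close> is
  continuous. Hence the relation \<open>q' = \<eta>' f'\<close> makes sense for every convex \<open>\<eta>\<close> as follows; continuity
  of \<open>q\<close> makes it equivalent to \<open>q(s) = q(0) + \<integral>\<^sub>0\<^sup>s \<eta>' f'\<close>.
\<close>

definition entropy_pair ::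
    "(real \<Rightarrow> 'v::euclidean_space) \<Rightarrow> (real \<Rightarrow> real) \<Rightarrow> (real \<Rightarrow> 'v) \<Rightarrow> bool" where
  "entropy_pair f \<eta> q \<longleftrightarrow>
     convex_on UNIV \<eta> \<and> continuous_on UNIV q \<and>
     (\<forall>s m. (\<eta> has_real_derivative m) (at s) \<longrightarrow>
        (q has_vector_derivative (m *\<^sub>R vector_derivative f (at s))) (at s))"

definition test_functions :: "(real \<times> 'v::euclidean_space \<Rightarrow> real) set" where
  "test_functions =
     {\<phi>. smooth \<phi> \<and> compact (closure {z. \<phi> z \<noteq> 0}) \<and>
          closure {z. \<phi> z \<noteq> 0} \<subseteq> {0<..} \<times> UNIV \<and> (\<forall>z. \<phi> z \<ge> 0)}"

text \<open>
  The inequality \<open>\<partial>\<^sub>t \<eta>(u) + div\<^sub>x q(u) \<le> 0\<close> in the sense of distributions on \<open>(0,\<infinity>) \<times> \<real>\<^sup>d\<close>. With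
  \<open>D\<phi>\<close> the Frechet derivative, \<open>D\<phi>(1,0) = \<partial>\<^sub>t \<phi>\<close> and \<open>D\<phi>(0,w) = w \<bullet> \<nabla>\<^sub>x \<phi>\<close>.
\<close>

definition entropy_inequality ::
    "(real \<Rightarrow> real) \<Rightarrow> (real \<Rightarrow> 'v::euclidean_space) \<Rightarrow> (real \<Rightarrow> 'v \<Rightarrow> real) \<Rightarrow> bool" where
  "entropy_inequality \<eta> q u \<longleftrightarrow>
     (\<forall>\<phi>\<in>test_functions.
        (\<integral>(t, x). \<eta> (u t x) * frechet_derivative \<phi> (at (t, x)) (1, 0)
                  + frechet_derivative \<phi> (at (t, x)) (0, q (u t x))
           \<partial>lebesgue_on ({0<..} \<times> UNIV)) \<ge> 0)"

text \<open>Values \<open>u t\<close> for \<open>t < 0\<close> are irrelevant.\<close>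

definition kruzhkov_solution ::
    "(real \<Rightarrow> 'v::euclidean_space) \<Rightarrow> ('v \<Rightarrow> real) \<Rightarrow> (real \<Rightarrow> 'v \<Rightarrow> real) \<Rightarrow> bool" where
  "kruzhkov_solution f a u \<longleftrightarrow>
     (\<lambda>(t, x). u t x) \<in> Linf (lebesgue_on ({0<..} \<times> UNIV)) \<and>
     (\<forall>\<eta> q. entropy_pair f \<eta> q \<longrightarrow> entropy_inequality \<eta> q u) \<and>
     (\<forall>t\<ge>0. u t \<in> L1loc) \<and>
     (\<forall>K. compact K \<longrightarrow> (\<forall>t\<ge>0.
        ((\<lambda>s. LINT x:K|lebesgue. \<bar>u s x - u t x\<bar>) \<longlongrightarrow> 0) (at t within {0..}))) \<and>
     (AE x in lebesgue. u 0 x = a x)"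

text \<open>
  By uniqueness of the Kruzhkov solution, this determines \<open>S t a\<close> up to a null set for all \<open>t \<ge> 0\<close> and
  bounded measurable \<open>a\<close>; in particular it implies the semigroup law almost everywhere.
\<close>

definition kruzhkov_semigroup ::
    "(real \<Rightarrow> 'v::euclidean_space) \<Rightarrow> (real \<Rightarrow> ('v \<Rightarrow> real) \<Rightarrow> ('v \<Rightarrow> real)) \<Rightarrow> bool" where
  "kruzhkov_semigroup f S \<longleftrightarrow> (\<forall>a \<in> Linf lebesgue. kruzhkov_solution f a (\<lambda>t. S t a))"

end

theory Submission
  imports Defs "HOL-Computational_Algebra.Polynomial"
begin

text \<open>
  The squared distance to \<open>Q\<^sub>r\<close> is a supremum of convex entropies, up to constants. For bounded \<open>v\<close> in
  \<open>L\<^sup>2\<close>, Lagrangian duality for the constraint \<open>\<integral>\<bar>b\<bar> \<le> r\<close> gives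
  \<open>d\<^sub>2(v; Q\<^sub>r)\<^sup>2 = sup\<^bsub>l \<ge> 0\<^esub> (\<integral> h\<^sub>l(v) dx - 2 l r)\<close> with \<open>h\<^sub>l(s) = inf\<^sub>b ((s - b)\<^sup>2 + 2 l \<bar>b\<bar>)\<close>,
  and \<open>h\<^sub>l\<close> is the Huber function: \<open>s\<^sup>2\<close> for \<open>\<bar>s\<bar> \<le> l\<close> and \<open>2 l \<bar>s\<bar> - l\<^sup>2\<close> beyond. It is convex,
  nonnegative and Lipschitz, and vanishes at \<open>0\<close>. So the theorem follows once \<open>\<integral> h\<^sub>l(S\<^sub>t a) dx\<close> is
  known to be non-increasing in \<open>t\<close> for each \<open>l\<close>.

  The inequality \<open>d\<^sub>2 \<ge> sup\<close> is the pointwise bound \<open>huber_le\<close>. For the other one, the infimum defining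
  \<open>h\<^sub>l(s)\<close> is attained at the soft threshold \<open>b\<close> of \<open>s\<close>, that is \<open>s\<close> moved by \<open>l\<close> towards \<open>0\<close>
  (\<open>huber_soft_threshold\<close>), and \<open>l\<close> is chosen by the intermediate value theorem such that the soft
  threshold of \<open>v\<close> has \<open>L\<^sup>1\<close> norm exactly \<open>r\<close>, with \<open>l = 0\<close> if \<open>v\<close> already lies in \<open>Q\<^sub>r\<close>
  (\<open>soft_threshold_level\<close>). Both halves are combined in \<open>L2_dist_mono\<close>.

  The decay of \<open>\<integral> h\<^sub>l(u)\<close> (\<open>entropy_decay\<close>) comes from finite speed of propagation. Let \<open>\<eta> = h\<^sub>l\<close> and
  normalise the entropy flux by \<open>q(0) = 0\<close>. As \<open>\<eta>\<close> decreases before \<open>0\<close> and increases after it,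
  integrating \<open>q' = \<eta>' f'\<close> yields \<open>\<bar>q(u)\<bar> \<le> M \<eta>(u)\<close>, where \<open>M\<close> bounds \<open>\<bar>f'\<bar>\<close> on the range of \<open>u\<close>
  (\<open>flux_bound\<close>). Hence testing the entropy inequality with \<open>\<theta>(t) w(t,x)\<close>, where \<open>w \<ge> 0\<close> satisfies
  \<open>\<partial>\<^sub>t w + M \<bar>\<nabla>w\<bar> \<le> 0\<close>, leaves \<open>\<integral> \<theta>'(t) (\<integral> \<eta>(u) w dx) dt \<ge> 0\<close>: the local entropy \<open>\<integral> \<eta>(u) w dx\<close> is
  non-increasing in time. Such a weight is \<open>w = e(R\<^sup>2 - \<bar>x\<bar>\<^sup>2 - 2 M R t)\<close> with \<open>e(s) = exp (- 1 / s)\<close> for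
  \<open>s > 0\<close> and \<open>e(s) = 0\<close> otherwise, because \<open>w\<close> is supported in \<open>\<bar>x\<bar> \<le> R\<close>, where the gradient of \<open>\<bar>x\<bar>\<^sup>2\<close> is
  at most \<open>2 R\<close>. It tends to \<open>1\<close> as \<open>R \<rightarrow> \<infinity>\<close>, so that Fatou's lemma removes it.
\<close>

section \<open>Calculus of iterated directional derivatives\<close>

lemma k_smooth_SucI:
  assumes "\<And>x. (g has_derivative g' x) (at x)" and "\<And>v. k_smooth k (\<lambda>x. g' x v)"
  shows "k_smooth (Suc k) g"
proof -
  have "frechet_derivative g (at x) = g' x" for x
    using frechet_derivative_at[OF assms(1)] by simp
  then show ?thesis
    using assms by (auto simp: differentiable_def)
qed

lemma k_smooth_SucD:
  assumes "k_smooth (Suc k) g"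
  shows "(g has_derivative frechet_derivative g (at x)) (at x)"
    and "k_smooth k (\<lambda>x. frechet_derivative g (at x) v)"
  using assms by (simp_all add: frechet_derivative_works[symmetric])

lemma k_smooth_decrease: "k_smooth (Suc k) g \<Longrightarrow> k_smooth k g"
proof (induction k arbitrary: g)
  case 0
  then show ?case
    by (auto intro!: continuous_at_imp_continuous_on differentiable_imp_continuous_within)
next
  case (Suc k)
  have "\<forall>x. g differentiable at x" using Suc.prems by simp
  moreover have "k_smooth k (\<lambda>x. frechet_derivative g (at x) v)" for v
    by (rule Suc.IH[OF k_smooth_SucD(2)[OF Suc.prems]])
  ultimately show ?case by simp
qed

lemma k_smooth_const: "k_smooth k (\<lambda>_. c)"
proof (induction k arbitrary: c)
  case (Suc k)
  show ?case by (rule k_smooth_SucI[where g' = "\<lambda>_ _. 0"]) (auto simp: Suc)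
qed auto

lemma k_smooth_bounded_linear:
  assumes "bounded_linear g" shows "k_smooth k g"
proof (cases k)
  case 0
  then show ?thesis using assms by (simp add: linear_continuous_on)
next
  case (Suc j)
  show ?thesis unfolding Suc
    by (rule k_smooth_SucI[where g' = "\<lambda>_. g"])
       (auto simp: k_smooth_const bounded_linear_imp_has_derivative assms)
qed

lemma k_smooth_add:
  "k_smooth k g \<Longrightarrow> k_smooth k h \<Longrightarrow> k_smooth k (\<lambda>x. g x + h x)"
proof (induction k arbitrary: g h)
  case (Suc k)
  note D = Suc.prems[THEN k_smooth_SucD(1)] and S = Suc.prems[THEN k_smooth_SucD(2)]
  show ?case
    by (rule k_smooth_SucI[OF has_derivative_add[OF D]]) (intro Suc.IH S)
qed (simp add: continuous_on_add)

lemma k_smooth_mult: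
  fixes g h :: "'a::real_normed_vector \<Rightarrow> real"
  shows "k_smooth k g \<Longrightarrow> k_smooth k h \<Longrightarrow> k_smooth k (\<lambda>x. g x * h x)"
proof (induction k arbitrary: g h)
  case (Suc k)
  note D = Suc.prems[THEN k_smooth_SucD(1)] and S = Suc.prems[THEN k_smooth_SucD(2)]
    and L = Suc.prems[THEN k_smooth_decrease]
  show ?case
    by (rule k_smooth_SucI[OF has_derivative_mult[OF D]]) (intro k_smooth_add Suc.IH S L)
qed (simp add: continuous_on_mult)

text \<open>
  The derivative of the composition is a product that again contains a composition, of functions of one degree less; this is why the induction needs products and arbitrary \<open>g\<close>.
\<close>

lemma k_smooth_compose:
  fixes g :: "real \<Rightarrow> real" and h :: "'a::real_normed_vector \<Rightarrow> real"
  shows "k_smooth k g \<Longrightarrow> k_smooth k h \<Longrightarrow> k_smooth k (\<lambda>x. g (h x))"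
proof (induction k arbitrary: g h)
  case 0
  then show ?case by (auto intro: continuous_on_compose2)
next
  case (Suc k)
  note D = Suc.prems[THEN k_smooth_SucD(1)] and S = Suc.prems[THEN k_smooth_SucD(2)]
    and L = Suc.prems[THEN k_smooth_decrease]
  let ?g' = "\<lambda>y. frechet_derivative g (at y)"
  have "((\<lambda>x. g (h x)) has_derivative
      (\<lambda>v. frechet_derivative h (at x) v * ?g' (h x) 1)) (at x)" for x
  proof -
    have "?g' y v = v * ?g' y 1" for y v
      using linear_cmul[OF has_derivative_linear[OF D(1)[of y]], of v 1] by simp
    then have "(\<lambda>v. ?g' (h x) (frechet_derivative h (at x) v)) =
        (\<lambda>v. frechet_derivative h (at x) v * ?g' (h x) 1)"
      by blast
    with has_derivative_compose[OF D(2)[of x] D(1)] show ?thesis by argo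
  qed
  moreover have "k_smooth k (\<lambda>x. frechet_derivative h (at x) v * ?g' (h x) 1)" for v
    using k_smooth_mult[OF S(2) Suc.IH[OF S(1) L(2)]] .
  ultimately show ?case by (rule k_smooth_SucI)
qed

section \<open>The flat function \<open>exp (- 1 / x)\<close>\<close>

text \<open>
  With \<open>p = 1\<close> this is the classical smooth function that is flat at \<open>0\<close>. The polynomial factor makes the
  family closed under differentiation, so that one derivative formula gives smoothness.
\<close>

definition flat :: "real poly \<Rightarrow> real \<Rightarrow> real" where
  "flat p x = (if x > 0 then poly p (1 / x) * exp (- (1 / x)) else 0)"

lemma poly_times_exp_decay:
  fixes p :: "real poly"
  shows "((\<lambda>y. y ^ k * poly p y * exp (- y)) \<longlongrightarrow> 0) at_top"
proof (induction p arbitrary: k)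
  case (pCons a p)
  have "((\<lambda>y::real. a * (y ^ k / exp y) + y ^ Suc k * poly p y * exp (- y)) \<longlongrightarrow> a * 0 + 0) at_top"
    by (intro tendsto_intros pCons.IH tendsto_power_div_exp_0)
  moreover have "a * (y ^ k / exp y) + y ^ Suc k * poly p y * exp (- y) =
      y ^ k * poly (pCons a p) y * exp (- y)" for y :: real
    by (simp add: exp_minus divide_inverse algebra_simps)
  ultimately show ?case by simp
qed simp

text \<open>
  Away from \<open>0\<close> this is the chain rule. At \<open>0\<close> the substitution \<open>y = 1 / x\<close> turns the difference quotient
  into a polynomial in \<open>y\<close> times \<open>exp (- y)\<close>.
\<close>

lemma flat_has_derivative:
  "(flat p has_real_derivative flat ([:0, 0, 1:] * (p - pderiv p)) x) (at x)"
proof -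
  consider "x < 0" | "x > 0" | "x = 0" by linarith
  then show ?thesis
  proof cases
    case 1
    have "((\<lambda>_. 0) has_real_derivative 0) (at x)" by simp
    moreover have "\<forall>\<^sub>F y in nhds x. flat p y = 0"
      using eventually_nhds_in_open[of "{..<0}" x] 1 by (auto elim!: eventually_mono simp: flat_def)
    ultimately show ?thesis
      using 1 by (subst DERIV_cong_ev[OF refl _ refl, of _ "\<lambda>_. 0"]) (auto simp: flat_def)
  next
    case 2
    have "((\<lambda>y. poly p (1 / y) * exp (- (1 / y))) has_real_derivative
        (poly (pderiv p) (1 / x) * (- 1 / (x * x)) * exp (- (1 / x)) +
          poly p (1 / x) * (exp (- (1 / x)) * (1 / (x * x))))) (at x)"
      using 2 by (auto intro!: derivative_eq_intros DERIV_chain2[OF poly_DERIV])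
    moreover have "\<forall>\<^sub>F y in nhds x. flat p y = poly p (1 / y) * exp (- (1 / y))"
      using eventually_nhds_in_open[of "{0<..}" x] 2 by (auto elim!: eventually_mono simp: flat_def)
    ultimately show ?thesis
      using 2 by (subst DERIV_cong_ev[OF refl _ refl]) (auto simp: flat_def field_simps)
  next
    case 3
    have "((\<lambda>h. inverse h ^ 1 * poly p (inverse h) * exp (- inverse h)) \<longlongrightarrow> 0) (at_right (0::real))"
      by (rule filterlim_compose[OF poly_times_exp_decay filterlim_inverse_at_top_right])
    moreover have "\<forall>\<^sub>F h in at_right 0.
        inverse h ^ 1 * poly p (inverse h) * exp (- inverse h) = (flat p (0 + h) - flat p 0) / h"
      using eventually_at_right_less[of 0]
      by eventually_elim (simp add: flat_def inverse_eq_divide)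
    ultimately have "((\<lambda>h. (flat p (0 + h) - flat p 0) / h) \<longlongrightarrow> 0) (at_right 0)"
      by (rule Lim_transform_eventually)
    moreover have "\<forall>\<^sub>F h in at_left 0. (flat p (0 + h) - flat p 0) / h = 0"
      unfolding eventually_at_filter by (rule always_eventually) (auto simp: flat_def)
    then have "((\<lambda>h. (flat p (0 + h) - flat p 0) / h) \<longlongrightarrow> 0) (at_left 0)"
      by (rule tendsto_eventually)
    ultimately show ?thesis
      using 3 by (simp add: DERIV_def filterlim_at_split flat_def)
  qed
qed

lemma smooth_flat: "k_smooth k (flat p)"
proof (induction k arbitrary: p)
  case 0
  have "isCont (flat p) x" for x
    by (rule DERIV_isCont[OF flat_has_derivative])
  then show ?case by (simp add: continuous_at_imp_continuous_on)
next
  case (Suc k)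
  let ?p' = "[:0, 0, 1:] * (p - pderiv p)"
  have "(flat p has_derivative (\<lambda>v. flat ?p' x * v)) (at x)" for x
    using flat_has_derivative[of p x] by (simp only: has_field_derivative_def)
  moreover have "k_smooth k (\<lambda>x. flat ?p' x * v)" for v
    by (intro k_smooth_mult k_smooth_const Suc)
  ultimately show ?case by (rule k_smooth_SucI)
qed

lemma continuous_flat: "continuous_on A (flat p)"
  using smooth_flat[of 0 p] continuous_on_subset by auto

lemma flat_one_has_derivative: "(flat 1 has_real_derivative flat [:0, 0, 1:] x) (at x)"
  using flat_has_derivative[of 1 x] by (simp add: pderiv_1)

lemma flat_one_le_1: "flat 1 x \<le> 1" and flat_one_nonneg: "0 \<le> flat 1 x"
  by (auto simp: flat_def)

lemma flat_deriv_nonneg: "0 \<le> flat [:0, 0, 1:] x"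
  by (simp add: flat_def)

text \<open>
  With \<open>y = 1 / x\<close> the claim is \<open>y\<^sup>2 / 2 \<le> exp y\<close>, from the Taylor expansion of the exponential.
\<close>

lemma flat_deriv_le: "flat [:0, 0, 1:] x \<le> 2"
proof (cases "x > 0")
  case True
  let ?y = "1 / x"
  have "?y\<^sup>2 / 2 \<le> exp ?y"
    using exp_lower_Taylor_quadratic[of ?y] True by (smt (verit) divide_pos_pos)
  then have "?y\<^sup>2 * exp (- ?y) \<le> 2"
    using mult_right_mono[of "?y\<^sup>2" "2 * exp ?y" "exp (- ?y)"] by (simp add: exp_minus mult_ac)
  then show ?thesis using True by (simp add: flat_def power2_eq_square)
qed (simp add: flat_def)

lemma flat_one_lipschitz: "\<bar>flat 1 x - flat 1 y\<bar> \<le> 2 * \<bar>x - y\<bar>"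
proof -
  have "norm (flat 1 x - flat 1 y) \<le> 2 * norm (x - y)"
    by (rule field_differentiable_bound[of UNIV "flat 1" "flat [:0, 0, 1:]"])
       (auto simp: abs_of_nonneg flat_deriv_nonneg flat_deriv_le
         intro: flat_one_has_derivative DERIV_subset)
  then show ?thesis by simp
qed

section \<open>Monotone functions and weak derivatives\<close>

lemma antiderivative_exists:
  fixes g :: "real \<Rightarrow> 'v::euclidean_space"
  assumes "continuous_on UNIV g"
  obtains q where "q 0 = 0" "\<And>s. (q has_vector_derivative g s) (at s)"
proof -
  have "\<exists>F. \<forall>x. -\<infinity> < ereal x \<longrightarrow> ereal x < \<infinity> \<longrightarrow> (F has_vector_derivative g x) (at x)"
    by (rule einterval_antiderivative)
       (use assms in \<open>auto simp: continuous_on_eq_continuous_at\<close>)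
  then obtain F where "\<And>x. (F has_vector_derivative g x) (at x)" by auto
  then have "((\<lambda>s. F s - F 0) has_vector_derivative g s) (at s)" for s
    by (auto intro!: derivative_eq_intros)
  then show ?thesis using that[of "\<lambda>s. F s - F 0"] by simp
qed

text \<open>
  The step \<open>E\<close> is an antiderivative of the bump \<open>flat 1 (x - 1) * flat 1 (2 - x)\<close>. Starting the rise at \<open>1\<close>
  rather than \<open>0\<close> keeps the rescaled steps used below supported in times strictly after the base point,
  even if that is \<open>0\<close>.
\<close>

lemma smooth_step_exists:
  obtains E \<rho> :: "real \<Rightarrow> real" where
    "\<And>x. (E has_real_derivative \<rho> x) (at x)" "\<And>k. k_smooth k E"
    "\<And>x. x \<le> 1 \<Longrightarrow> E x = 0" "\<And>x. 2 \<le> x \<Longrightarrow> E x = E 2" "mono E" "0 < E 2"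
    "\<And>x. 0 \<le> \<rho> x" "\<And>x. x \<notin> {1..2} \<Longrightarrow> \<rho> x = 0" "continuous_on UNIV \<rho>"
proof -
  define \<rho> where "\<rho> = (\<lambda>x::real. flat 1 (x + (- 1)) * flat 1 ((- 1) * x + 2))"
  have smooth: "k_smooth k \<rho>" for k
    unfolding \<rho>_def
    by (intro k_smooth_mult k_smooth_compose[OF smooth_flat] k_smooth_add k_smooth_const
        k_smooth_bounded_linear[OF bounded_linear_ident])
  have cont: "continuous_on UNIV \<rho>" using smooth[of 0] by simp
  have nonneg: "0 \<le> \<rho> x" for x by (simp add: \<rho>_def flat_one_nonneg)
  have pos: "0 < \<rho> x" if "x \<in> {1<..<2}" for x
    using that by (simp add: \<rho>_def flat_def)
  have zero: "\<rho> x = 0" if "x \<notin> {1<..<2}" for x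
    using that by (auto simp: \<rho>_def flat_def)
  obtain F where "\<And>x. (F has_vector_derivative \<rho> x) (at x)"
    using antiderivative_exists[OF cont] by metis
  then have F: "(F has_real_derivative \<rho> x) (at x)" for x
    by (simp add: has_real_derivative_iff_has_vector_derivative)
  define E where "E x = F x - F 1" for x
  have E: "(E has_real_derivative \<rho> x) (at x)" for x
    unfolding E_def by (auto intro!: derivative_eq_intros F)
  have mono: "E x \<le> E y" if "x \<le> y" for x y
    using DERIV_nonneg_imp_nondecreasing[OF that, of E] E nonneg by blast
  have left: "E x = 0" if "x \<le> 1" for x
  proof (cases "x = 1")
    case False
    with that have "x < 1" by simp
    from MVT2[OF this, of E \<rho>] E obtain z where "x < z" "z < 1" "E 1 - E x = (1 - x) * \<rho> z"
      by blast
    then show ?thesis using zero[of z] by (simp add: E_def)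
  qed (simp add: E_def)
  have right: "E x = E 2" if "2 \<le> x" for x
  proof (cases "x = 2")
    case False
    with that have "2 < x" by simp
    from MVT2[OF this, of E \<rho>] E obtain z where "2 < z" "z < x" "E x - E 2 = (x - 2) * \<rho> z"
      by blast
    then show ?thesis using zero[of z] by simp
  qed simp
  have "0 < E 2"
  proof -
    from MVT2[of 1 2 E \<rho>] E obtain z where "1 < z" "z < 2" "E 2 - E 1 = (2 - 1) * \<rho> z"
      by auto
    then show ?thesis using pos[of z] left[of 1] by simp
  qed
  moreover have "k_smooth k E" for k
  proof (cases k)
    case 0
    then show ?thesis using E by (auto intro!: continuous_at_imp_continuous_on DERIV_isCont)
  next
    case (Suc j)
    have "(E has_derivative (\<lambda>v. \<rho> x * v)) (at x)" for x
      using E[of x] by (simp only: has_field_derivative_def)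
    moreover have "k_smooth j (\<lambda>x. \<rho> x * v)" for v
      by (intro k_smooth_mult k_smooth_const smooth)
    ultimately show ?thesis unfolding Suc by (rule k_smooth_SucI)
  qed
  ultimately show ?thesis
    using that[OF E _ left right _ _ nonneg _ cont] mono zero by (force simp: mono_def)
qed

text \<open>
  Integrating \<open>F\<close> against the rescaled bump is \<open>E 2\<close> times an average of \<open>F\<close> just after time \<open>s\<close>.
\<close>

lemma bump_average:
  fixes F E \<rho> :: "real \<Rightarrow> real"
  assumes E: "\<And>x. (E has_real_derivative \<rho> x) (at x)" and "E 0 = 0"
    and \<rho>: "\<And>x. 0 \<le> \<rho> x" "\<And>x. x \<notin> {1..2} \<Longrightarrow> \<rho> x = 0" "continuous_on UNIV \<rho>"
    and F: "continuous_on {0..} F" and "0 \<le> s" "0 < \<delta>"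
  defines "g \<equiv> \<lambda>\<tau>. \<rho> ((\<tau> - s) / \<delta>) / \<delta>"
  shows "set_integrable lborel {0<..} (\<lambda>\<tau>. F \<tau> * g \<tau>)"
    and "(\<And>\<tau>. \<tau> \<in> {s..s + 2 * \<delta>} \<Longrightarrow> F \<tau> \<le> k) \<Longrightarrow>
      (LINT \<tau>:{0<..}|lborel. F \<tau> * g \<tau>) \<le> k * E 2"
    and "(\<And>\<tau>. \<tau> \<in> {s..s + 2 * \<delta>} \<Longrightarrow> k \<le> F \<tau>) \<Longrightarrow>
      k * E 2 \<le> (LINT \<tau>:{0<..}|lborel. F \<tau> * g \<tau>)"
proof -
  let ?I = "{s..s + 2 * \<delta>}"
  have cont: "continuous_on UNIV g"
    unfolding g_def using \<open>0 < \<delta>\<close>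
    by (intro continuous_intros continuous_on_compose2[OF \<rho>(3)]) auto
  have "g \<tau> = 0" if "\<tau> \<notin> ?I \<or> \<tau> \<le> 0" for \<tau>
    using that \<open>0 < \<delta>\<close> \<open>0 \<le> s\<close>
    by (auto simp: g_def field_simps intro!: \<rho>(2))
  then have eq: "(\<lambda>\<tau>. indicator {0<..} \<tau> *\<^sub>R (F \<tau> * g \<tau>)) = (\<lambda>\<tau>. indicator ?I \<tau> *\<^sub>R (F \<tau> * g \<tau>))"
    by (auto simp: indicator_def fun_eq_iff)
  have "continuous_on ?I F" by (rule continuous_on_subset[OF F]) (use \<open>0 \<le> s\<close> in auto)
  then have int: "set_integrable lborel ?I (\<lambda>\<tau>. F \<tau> * g \<tau>)"
    by (intro borel_integrable_atLeastAtMost' continuous_on_mult continuous_on_subset[OF cont]) auto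
  then show "set_integrable lborel {0<..} (\<lambda>\<tau>. F \<tau> * g \<tau>)"
    unfolding set_integrable_def eq .
  have "((\<lambda>\<tau>. E ((\<tau> - s) / \<delta>)) has_real_derivative g \<tau>) (at \<tau>)" for \<tau>
    unfolding g_def
    using DERIV_chain2[OF E, of "\<lambda>\<tau>. (\<tau> - s) / \<delta>" "1 / \<delta>" \<tau> UNIV] DERIV_cdivide[OF DERIV_diff[OF DERIV_ident DERIV_const[of s]], of \<delta> \<tau> UNIV]
    by simp
  then have "has_bochner_integral lborel (\<lambda>\<tau>. g \<tau> * indicator ?I \<tau>)
      (E ((s + 2 * \<delta> - s) / \<delta>) - E ((s - s) / \<delta>))"
    using \<open>0 < \<delta>\<close> cont
    by (intro has_bochner_integral_FTC_Icc_real)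
       (auto simp: continuous_on_eq_continuous_at)
  then have total: "(LINT \<tau>:?I|lborel. g \<tau>) = E 2" and g: "set_integrable lborel ?I g"
    using \<open>0 < \<delta>\<close> \<open>E 0 = 0\<close>
    by (auto simp: set_lebesgue_integral_def set_integrable_def mult.commute has_bochner_integral_iff)
  have const: "(LINT \<tau>:?I|lborel. k * g \<tau>) = k * E 2" and const': "set_integrable lborel ?I (\<lambda>\<tau>. k * g \<tau>)"
    using total g by auto
  have g0: "0 \<le> g \<tau>" for \<tau> using \<rho>(1) \<open>0 < \<delta>\<close> by (simp add: g_def)
  have restrict: "(LINT \<tau>:{0<..}|lborel. F \<tau> * g \<tau>) = (LINT \<tau>:?I|lborel. F \<tau> * g \<tau>)"
    unfolding set_lebesgue_integral_def eq ..
  show "(LINT \<tau>:{0<..}|lborel. F \<tau> * g \<tau>) \<le> k * E 2" if "\<And>\<tau>. \<tau> \<in> ?I \<Longrightarrow> F \<tau> \<le> k"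
    unfolding restrict const[symmetric]
    by (rule set_integral_mono[OF int const']) (use that g0 in \<open>simp add: mult_right_mono\<close>)
  show "k * E 2 \<le> (LINT \<tau>:{0<..}|lborel. F \<tau> * g \<tau>)" if "\<And>\<tau>. \<tau> \<in> ?I \<Longrightarrow> k \<le> F \<tau>"
    unfolding restrict const[symmetric]
    by (rule set_integral_mono[OF const' int]) (use that g0 in \<open>simp add: mult_right_mono\<close>)
qed

text \<open>
  If \<open>F s < F t\<close> with \<open>s < t\<close>, take for \<open>\<theta>\<close> a smooth version of the indicator of \<open>[s,t]\<close>: a step up after \<open>s\<close>
  minus a step up after \<open>t\<close>. Then \<open>\<integral> F \<theta>'\<close> is a positive multiple of an average of \<open>F\<close> near \<open>s\<close> minus
  an average near \<open>t\<close>, hence negative by continuity.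
\<close>

lemma antimono_on_if_derivative_le_0_weakly:
  fixes F :: "real \<Rightarrow> real"
  assumes F: "continuous_on {0..} F"
    and weak: "\<And>\<theta> \<theta>' a b. \<lbrakk>0 < a; \<And>k. k_smooth k \<theta>; continuous_on UNIV \<theta>';
        \<And>\<tau>. (\<theta> has_real_derivative \<theta>' \<tau>) (at \<tau>); \<And>\<tau>. 0 \<le> \<theta> \<tau>; \<And>\<tau>. \<tau> \<notin> {a..b} \<Longrightarrow> \<theta> \<tau> = 0 \<and> \<theta>' \<tau> = 0\<rbrakk>
      \<Longrightarrow> 0 \<le> (LINT \<tau>:{0<..}|lborel. F \<tau> * \<theta>' \<tau>)"
  shows "antimono_on {0..} F"
proof (rule monotone_onI, rule ccontr)
  fix s t :: real
  assume st: "s \<in> {0..}" "t \<in> {0..}" "s \<le> t" and "\<not> F t \<le> F s"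
  then have "F s < F t" by simp
  define m where "m = (F s + F t) / 2"
  obtain E \<rho> :: "real \<Rightarrow> real" where
    E: "\<And>x. (E has_real_derivative \<rho> x) (at x)" "\<And>k. k_smooth k E"
      "\<And>x. x \<le> 1 \<Longrightarrow> E x = 0" "\<And>x. 2 \<le> x \<Longrightarrow> E x = E 2" "mono E" "0 < E 2"
    and \<rho>: "\<And>x. 0 \<le> \<rho> x" "\<And>x. x \<notin> {1..2} \<Longrightarrow> \<rho> x = 0" "continuous_on UNIV \<rho>"
    using smooth_step_exists by metis
  define \<epsilon> where "\<epsilon> = (F t - F s) / 4"
  have "0 < \<epsilon>" using \<open>F s < F t\<close> by (simp add: \<epsilon>_def)
  have "\<forall>p\<in>{0..}. \<exists>d>0. \<forall>\<tau>\<in>{0..}. dist \<tau> p < d \<longrightarrow> dist (F \<tau>) (F p) < \<epsilon>"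
    using F \<open>0 < \<epsilon>\<close> unfolding continuous_on_iff by blast
  then obtain d1 d2 where d: "0 < d1" "0 < d2"
    "\<And>\<tau>. 0 \<le> \<tau> \<Longrightarrow> \<bar>\<tau> - s\<bar> < d1 \<Longrightarrow> \<bar>F \<tau> - F s\<bar> < \<epsilon>"
    "\<And>\<tau>. 0 \<le> \<tau> \<Longrightarrow> \<bar>\<tau> - t\<bar> < d2 \<Longrightarrow> \<bar>F \<tau> - F t\<bar> < \<epsilon>"
    using st unfolding dist_real_def by (metis atLeast_iff)
  define \<delta> where "\<delta> = min d1 d2 / 3"
  have \<delta>: "0 < \<delta>" "2 * \<delta> < d1" "2 * \<delta> < d2" using d(1,2) by (auto simp: \<delta>_def)
  define g where "g p \<tau> = \<rho> ((\<tau> - p) / \<delta>) / \<delta>" for p \<tau>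
  have "E 0 = 0" using E(3) by simp
  note avg = bump_average[OF E(1) \<open>E 0 = 0\<close> \<rho> F _ \<delta>(1), folded g_def]
  have low: "F \<tau> \<le> m - \<epsilon>" if "\<tau> \<in> {s..s + 2 * \<delta>}" for \<tau>
    
  proof -
    have "\<bar>F \<tau> - F s\<bar> < \<epsilon>" using that st \<delta> by (intro d(3)) auto
    then have "F \<tau> - F s < \<epsilon>" by linarith
    then show ?thesis by (simp add: m_def \<epsilon>_def field_simps)
  qed
  have high: "m + \<epsilon> \<le> F \<tau>" if "\<tau> \<in> {t..t + 2 * \<delta>}" for \<tau>
    
  proof -
    have "\<bar>F \<tau> - F t\<bar> < \<epsilon>" using that st \<delta> by (intro d(4)) auto
    then have "F t - F \<tau> < \<epsilon>" by linarith
    then show ?thesis by (simp add: m_def \<epsilon>_def field_simps)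
  qed
  \<comment> \<open>Sums and products with constants, so that the closure properties of smooth functions apply directly.\<close>
  define \<theta> where "\<theta> \<tau> = E ((1 / \<delta>) * \<tau> + (- s / \<delta>)) + (- 1) * E ((1 / \<delta>) * \<tau> + (- t / \<delta>))" for \<tau>
  have \<theta>: "\<theta> \<tau> = E ((\<tau> - s) / \<delta>) - E ((\<tau> - t) / \<delta>)" for \<tau>
    by (simp add: \<theta>_def diff_divide_distrib)
  have "0 \<le> (LINT \<tau>:{0<..}|lborel. F \<tau> * (g s \<tau> - g t \<tau>))"
  proof (rule weak)
    show "0 < s + \<delta>" using st \<delta> by simp
    show "k_smooth k \<theta>" for k
      unfolding \<theta>_def
      by (intro k_smooth_add k_smooth_mult k_smooth_const k_smooth_compose[OF E(2)]
          k_smooth_bounded_linear[OF bounded_linear_ident])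
    show "continuous_on UNIV (\<lambda>\<tau>. g s \<tau> - g t \<tau>)"
      unfolding g_def using \<delta>
      by (intro continuous_intros continuous_on_compose2[OF \<rho>(3)]) auto
    show "(\<theta> has_real_derivative g s \<tau> - g t \<tau>) (at \<tau>)" for \<tau>
      unfolding \<theta> g_def using \<delta>
      by (auto intro!: derivative_eq_intros DERIV_chain2[OF E(1)])
    show "0 \<le> \<theta> \<tau>" for \<tau>
      using monoD[OF E(5), of "(\<tau> - t) / \<delta>" "(\<tau> - s) / \<delta>"] st \<delta>
      by (simp add: \<theta> divide_right_mono)
    show "\<theta> \<tau> = 0 \<and> g s \<tau> - g t \<tau> = 0" if "\<tau> \<notin> {s + \<delta>..t + 2 * \<delta>}" for \<tau>
    proof (cases "\<tau> < s + \<delta>")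
      case True
      then have "(\<tau> - s) / \<delta> < 1" "(\<tau> - t) / \<delta> < 1" using st \<delta> by (auto simp: field_simps)
      then show ?thesis by (simp add: \<theta> g_def E(3) \<rho>(2))
    next
      case False
      with that have "2 < (\<tau> - s) / \<delta>" "2 < (\<tau> - t) / \<delta>" using st \<delta> by (auto simp: field_simps)
      then show ?thesis using E(4)[of "(\<tau> - s) / \<delta>"] E(4)[of "(\<tau> - t) / \<delta>"]
        by (simp add: \<theta> g_def \<rho>(2))
    qed
  qed
  also have "(LINT \<tau>:{0<..}|lborel. F \<tau> * (g s \<tau> - g t \<tau>)) =
      (LINT \<tau>:{0<..}|lborel. F \<tau> * g s \<tau>) - (LINT \<tau>:{0<..}|lborel. F \<tau> * g t \<tau>)"
    using avg(1)[of s] avg(1)[of t] st by (simp add: right_diff_distrib)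
  also have "\<dots> \<le> (m - \<epsilon>) * E 2 - (m + \<epsilon>) * E 2"
    using avg(2)[of s "m - \<epsilon>"] avg(3)[of t "m + \<epsilon>"] low high st by (intro diff_mono) auto
  also have "\<dots> < 0" using \<open>0 < \<epsilon>\<close> E(6) by (simp add: algebra_simps)
  finally show False by simp
qed

section \<open>The Huber function and soft thresholding\<close>

definition trunc :: "real \<Rightarrow> real \<Rightarrow> real" where
  "trunc l v = max (- l) (min l v)"

text \<open>
  This form exhibits \<open>huber l v\<close> as the maximum of the affine functions \<open>v \<mapsto> 2 v p - p\<^sup>2\<close> over \<open>\<bar>p\<bar> \<le> l\<close>,
  attained at \<open>p = trunc l v\<close>. It equals \<open>v\<^sup>2\<close> for \<open>\<bar>v\<bar> \<le> l\<close> and \<open>2 l \<bar>v\<bar> - l\<^sup>2\<close> otherwise.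
\<close>

definition huber :: "real \<Rightarrow> real \<Rightarrow> real" where
  "huber l v = 2 * v * trunc l v - (trunc l v)\<^sup>2"

lemma trunc_bound: "0 \<le> l \<Longrightarrow> \<bar>trunc l v\<bar> \<le> l"
  by (auto simp: trunc_def)

lemma trunc_lipschitz: "\<bar>trunc l v - trunc l w\<bar> \<le> \<bar>v - w\<bar>"
  by (auto simp: trunc_def)

lemma continuous_trunc: "continuous_on A (trunc l)"
  unfolding trunc_def by (intro continuous_intros)

lemma huber_ge_affine:
  assumes "\<bar>p\<bar> \<le> l" shows "2 * v * p - p\<^sup>2 \<le> huber l v"
proof -
  have "0 \<le> (trunc l v - p) * (2 * v - trunc l v - p)"
    using assms by (auto simp: trunc_def max_def min_def mult_nonneg_nonneg mult_nonpos_nonpos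
        abs_le_iff zero_le_mult_iff)
  then show ?thesis by (simp add: huber_def algebra_simps power2_eq_square)
qed

lemma huber_nonneg: "0 \<le> l \<Longrightarrow> 0 \<le> huber l v"
  using huber_ge_affine[of 0 l v] by simp

lemma huber_0: "0 \<le> l \<Longrightarrow> huber l 0 = 0"
  by (simp add: huber_def trunc_def)

text \<open>
  Maximality at \<open>v\<close>, respectively at \<open>w\<close>, compared with the maximiser at the other point.
\<close>

lemma huber_increment:
  assumes "0 \<le> l"
  shows "2 * trunc l v * (w - v) \<le> huber l w - huber l v"
    and "huber l w - huber l v \<le> 2 * trunc l w * (w - v)"
  using huber_ge_affine[OF trunc_bound[OF assms], where v = w and v1 = v]
    huber_ge_affine[OF trunc_bound[OF assms], where v = v and v1 = w]
  by (simp_all add: huber_def algebra_simps)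

lemma huber_lipschitz:
  assumes "0 \<le> l" shows "\<bar>huber l w - huber l v\<bar> \<le> 2 * l * \<bar>w - v\<bar>"
proof -
  have "\<bar>2 * trunc l z * (w - v)\<bar> \<le> 2 * l * \<bar>w - v\<bar>" for z
    using trunc_bound[OF assms, of z] by (simp add: abs_mult mult_right_mono)
  from this[of v] this[of w] huber_increment[OF assms, where v = v and w = w]
  show ?thesis by linarith
qed

text \<open>
  By \<open>huber_increment\<close> the increment differs from the linear term by at most
  \<open>2 (trunc l w - trunc l v) (w - v)\<close>, which is at most quadratic in \<open>w - v\<close> since \<open>trunc l\<close> is a contraction. No case
  distinction at the points \<open>\<plusminus> l\<close> arises.
\<close>

lemma huber_has_derivative:
  assumes "0 \<le> l"
  shows "(huber l has_real_derivative 2 * trunc l v) (at v)"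
proof -
  have bound: "\<bar>(huber l w - huber l v) / (w - v) - 2 * trunc l v\<bar> \<le> 2 * \<bar>w - v\<bar>" if "w \<noteq> v" for w
  proof -
    have "\<bar>huber l w - huber l v - 2 * trunc l v * (w - v)\<bar> \<le> 2 * (trunc l w - trunc l v) * (w - v)"
      using huber_increment[OF assms, where v = v and w = w] by (simp add: algebra_simps)
    also have "\<dots> \<le> 2 * (\<bar>trunc l w - trunc l v\<bar> * \<bar>w - v\<bar>)"
      by (metis abs_ge_self abs_mult mult.assoc mult_left_mono zero_le_numeral)
    also have "\<dots> \<le> 2 * (\<bar>w - v\<bar> * \<bar>w - v\<bar>)"
      by (intro mult_left_mono mult_right_mono trunc_lipschitz) auto
    finally have "\<bar>huber l w - huber l v - 2 * trunc l v * (w - v)\<bar> \<le> 2 * \<bar>w - v\<bar> * \<bar>w - v\<bar>"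
      by simp
    moreover have "(huber l w - huber l v) / (w - v) - 2 * trunc l v =
        (huber l w - huber l v - 2 * trunc l v * (w - v)) / (w - v)"
      using that by (simp add: diff_divide_distrib)
    ultimately show ?thesis using that by (simp only: abs_divide) (simp add: divide_le_eq)
  qed
  have "((\<lambda>w. (huber l w - huber l v) / (w - v) - 2 * trunc l v) \<longlongrightarrow> 0) (at v)"
  proof (rule Lim_null_comparison)
    show "\<forall>\<^sub>F w in at v. norm ((huber l w - huber l v) / (w - v) - 2 * trunc l v) \<le> 2 * \<bar>w - v\<bar>"
      using bound by (simp add: eventually_at_filter)
    have "((\<lambda>w. 2 * \<bar>w - v\<bar>) \<longlongrightarrow> 2 * \<bar>v - v\<bar>) (at v)" by (intro tendsto_intros)
    then show "((\<lambda>w. 2 * \<bar>w - v\<bar>) \<longlongrightarrow> 0) (at v)" by simp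
  qed
  then show ?thesis
    by (simp add: has_field_derivative_iff LIM_zero_iff)
qed

lemma continuous_huber: "0 \<le> l \<Longrightarrow> continuous_on A (huber l)"
  by (intro continuous_at_imp_continuous_on ballI DERIV_isCont[OF huber_has_derivative])

lemma convex_huber: "0 \<le> l \<Longrightarrow> convex_on UNIV (huber l)"
  by (rule convex_on_realI[OF _ huber_has_derivative]) (auto simp: trunc_def)

text \<open>
  The weak half of the duality. With \<open>p = trunc l v\<close> it is the sum of \<open>0 \<le> (v - b - p)\<^sup>2\<close> and of
  \<open>p b \<le> l \<bar>b\<bar>\<close>, the latter doubled.
\<close>

lemma huber_le:
  assumes "0 \<le> l" shows "huber l v \<le> (v - b)\<^sup>2 + 2 * l * \<bar>b\<bar>"
proof -
  let ?p = "trunc l v"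
  have "?p * b \<le> l * \<bar>b\<bar>"
    using mult_right_mono[OF trunc_bound[OF assms, of v], of "\<bar>b\<bar>"] abs_ge_self[of "?p * b"]
    by (simp add: abs_mult)
  moreover have "0 \<le> (v - b - ?p)\<^sup>2" by simp
  ultimately show ?thesis by (simp add: huber_def power2_eq_square algebra_simps)
qed

text \<open>
  Equality in \<open>huber_le\<close> at the soft threshold \<open>b = v - trunc l v\<close>.
\<close>

lemma huber_soft_threshold:
  assumes "0 \<le> l"
  shows "huber l v = (v - (v - trunc l v))\<^sup>2 + 2 * l * \<bar>v - trunc l v\<bar>"
proof -
  have "trunc l v * (v - trunc l v) = l * \<bar>v - trunc l v\<bar>"
    using assms by (simp add: trunc_def max_def min_def algebra_simps)
  then show ?thesis by (simp add: huber_def power2_eq_square algebra_simps)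
qed

lemma abs_minus_trunc: "0 \<le> l \<Longrightarrow> \<bar>v - trunc l v\<bar> = max 0 (\<bar>v\<bar> - l)"
  by (auto simp: trunc_def)

section \<open>Flux bounds\<close>

lemma smooth_imp_continuous_derivative:
  fixes f :: "real \<Rightarrow> 'v::real_normed_vector"
  assumes "smooth f"
  shows "continuous_on UNIV (\<lambda>s. vector_derivative f (at s))"
proof -
  have "k_smooth (Suc 0) f" using assms unfolding smooth_def by blast
  note D = k_smooth_SucD[OF this]
  have "(f has_vector_derivative frechet_derivative f (at s) 1) (at s)" for s
  proof -
    have "frechet_derivative f (at s) h = h *\<^sub>R frechet_derivative f (at s) 1" for h
      using linear_cmul[OF has_derivative_linear[OF D(1)[of s]], of h 1] by simp
    then have "frechet_derivative f (at s) = (\<lambda>h. h *\<^sub>R frechet_derivative f (at s) 1)"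
      by blast
    with D(1)[of s] show ?thesis unfolding has_vector_derivative_def by argo
  qed
  then have "vector_derivative f (at s) = frechet_derivative f (at s) 1" for s
    by (rule vector_derivative_at)
  then show ?thesis using D(2)[of 1] by simp
qed

text \<open>
  The sign condition on \<open>\<eta>'\<close> makes \<open>\<bar>\<eta>'\<bar>\<close> equal to \<open>\<eta>'\<close> on one side of \<open>0\<close> and to \<open>- \<eta>'\<close> on the other, so the
  bound \<open>\<bar>q'\<bar> \<le> M \<bar>\<eta>'\<bar>\<close> integrates from \<open>0\<close> to \<open>v\<close> on either side.
\<close>

lemma flux_bound:
  fixes q :: "real \<Rightarrow> 'v::euclidean_space"
  assumes q: "q 0 = 0" "\<And>s. (q has_vector_derivative (\<eta>' s *\<^sub>R g s)) (at s)"
    and \<eta>: "\<eta> 0 = 0" "\<And>s. (\<eta> has_real_derivative \<eta>' s) (at s)" "\<And>s. 0 \<le> s * \<eta>' s"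
    and M: "\<And>s. \<bar>s\<bar> \<le> B \<Longrightarrow> norm (g s) \<le> M" and "\<bar>v\<bar> \<le> B"
  shows "norm (q v) \<le> M * \<eta> v"
proof -
  have cq: "continuous_on A q" for A
    using q(2) by (meson continuous_at_imp_continuous_on has_vector_derivative_continuous)
  have c\<eta>: "continuous_on A \<eta>" for A
    using \<eta>(2) by (meson continuous_at_imp_continuous_on DERIV_isCont)
  have d\<eta>: "((\<lambda>s. k * \<eta> s) has_vector_derivative k * \<eta>' s) (at s)" for s k
    using DERIV_cmult[OF \<eta>(2)] by (simp add: has_real_derivative_iff_has_vector_derivative)
  have bd: "norm (\<eta>' s *\<^sub>R g s) \<le> M * \<bar>\<eta>' s\<bar>" if "\<bar>s\<bar> \<le> B" for s
    using mult_left_mono[OF M[OF that], of "\<bar>\<eta>' s\<bar>"] by (simp add: mult.commute)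
  consider "v = 0" | "0 < v" | "v < 0" by linarith
  then show ?thesis
  proof cases
    case 2
    have "norm (q v - q 0) \<le> M * \<eta> v - M * \<eta> 0"
    proof (rule differentiable_bound_general[OF 2 cq _ q(2) d\<eta>])
      fix s assume s: "0 < s" "s < v"
      then have "0 \<le> \<eta>' s" using \<eta>(3)[of s] by (simp add: zero_le_mult_iff)
      then show "norm (\<eta>' s *\<^sub>R g s) \<le> M * \<eta>' s" using bd[of s] s \<open>\<bar>v\<bar> \<le> B\<close> by simp
    qed (intro continuous_intros c\<eta>)
    then show ?thesis using q \<eta> by simp
  next
    case 3
    have "norm (q 0 - q v) \<le> (- M) * \<eta> 0 - (- M) * \<eta> v"
    proof (rule differentiable_bound_general[OF 3 cq _ q(2) d\<eta>])
      fix s assume s: "v < s" "s < 0"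
      then have "\<eta>' s \<le> 0" using \<eta>(3)[of s] by (simp add: zero_le_mult_iff)
      then show "norm (\<eta>' s *\<^sub>R g s) \<le> (- M) * \<eta>' s" using bd[of s] s \<open>\<bar>v\<bar> \<le> B\<close> by simp
    qed (intro continuous_intros c\<eta>)
    then show ?thesis using q \<eta> by simp
  qed (simp add: q \<eta>)
qed

section \<open>Fubini's theorem for Lebesgue measurable functions\<close>

lemma AE_lebesgue_prod:
  fixes P :: "'a::euclidean_space \<times> 'b::euclidean_space \<Rightarrow> bool"
  assumes "AE z in lebesgue. P z"
  shows "AE x in lebesgue. AE y in lebesgue. P (x, y)"
proof -
  have "AE z in lborel \<Otimes>\<^sub>M lborel. P z"
    using assms unfolding lborel_prod AE_completion_iff .
  then show ?thesis
    by (simp add: AE_completion_iff lborel_pair.AE_pair)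
qed

text \<open>
  The Lebesgue measure of the product is the completion of the product measure. Replacing \<open>H\<close> by an almost
  everywhere equal Borel function reduces the claim to Fubini's theorem for \<open>lborel\<close>.
\<close>

lemma Fubini_lebesgue:
  fixes H :: "'a::euclidean_space \<times> 'b::euclidean_space \<Rightarrow> real"
  assumes "integrable lebesgue H"
    and slice: "\<And>x. (\<lambda>y. H (x, y)) \<in> borel_measurable lebesgue"
    and outer: "(\<lambda>x. LINT y|lebesgue. H (x, y)) \<in> borel_measurable lborel"
  shows "(LINT z|lebesgue. H z) = (LINT x|lborel. LINT y|lebesgue. H (x, y))"
proof -
  obtain G where [measurable]: "G \<in> borel_measurable lborel" and ae: "AE z in lborel. H z = G z"
    using completion_ex_borel_measurable_real borel_measurable_integrable[OF assms(1)] by blast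
  have ae': "AE z in lebesgue. H z = G z" using ae by (simp add: AE_completion_iff)
  have Gm: "G \<in> borel_measurable lebesgue" by (rule measurable_completion) fact
  have "integrable lebesgue G"
    by (rule integrable_cong_AE_imp[OF assms(1) Gm]) (use ae' in \<open>auto simp: eq_commute\<close>)
  then have int: "integrable lborel G"
    by (simp add: integrable_completion)
  have "(LINT z|lebesgue. H z) = (LINT z|lebesgue. G z)"
    by (rule integral_cong_AE[OF borel_measurable_integrable[OF assms(1)] Gm ae'])
  also have "\<dots> = (LINT z|lborel. G z)" by (simp add: integral_completion)
  also have "\<dots> = (LINT x|lborel. LINT y|lborel. G (x, y))"
    using lborel_pair.integral_fst'[of G] int by (simp add: lborel_prod)
  also have "\<dots> = (LINT x|lborel. LINT y|lebesgue. H (x, y))"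
  proof (rule integral_cong_AE)
    have [measurable]: "G \<in> borel_measurable (borel \<Otimes>\<^sub>M borel)"
      by (simp add: borel_prod)
    show "(\<lambda>x. LINT y|lborel. G (x, y)) \<in> borel_measurable lborel"
      by measurable
    have "AE x in lborel. AE y in lborel. H (x, y) = G (x, y)"
      using AE_lebesgue_prod[OF ae'] by (simp add: AE_completion_iff)
    then show "AE x in lborel. (LINT y|lborel. G (x, y)) = (LINT y|lebesgue. H (x, y))"
    proof eventually_elim
      case (elim x)
      have m: "(\<lambda>y. G (x, y)) \<in> borel_measurable lborel" by measurable
      have "(LINT y|lborel. G (x, y)) = (LINT y|lebesgue. G (x, y))"
        using m by (simp add: integral_completion)
      also have "\<dots> = (LINT y|lebesgue. H (x, y))"
      proof (rule integral_cong_AE[OF measurable_completion[OF m] slice])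
        show "AE y in lebesgue. G (x, y) = H (x, y)"
          using elim by (simp add: AE_completion_iff eq_commute)
      qed
      finally show ?case .
    qed
  qed (rule outer)
  finally show ?thesis .
qed

section \<open>Locally integrable functions\<close>

lemma L1loc_integrable_cball:
  "v \<in> L1loc \<Longrightarrow> integrable lebesgue (\<lambda>x. indicator (cball 0 R) x * v x)"
  by (simp add: L1loc_def set_integrable_def)

lemma L1loc_integrable_abs_diff:
  assumes "v \<in> L1loc" "w \<in> L1loc"
  shows "integrable lebesgue (\<lambda>x. indicator (cball 0 R) x * \<bar>v x - w x\<bar>)"
proof -
  have "integrable lebesgue (\<lambda>x. \<bar>indicator (cball 0 R) x * v x - indicator (cball 0 R) x * w x\<bar>)"
    by (intro integrable_abs Bochner_Integration.integrable_diff L1loc_integrable_cball assms)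
  then show ?thesis
    by (rule Bochner_Integration.integrable_cong[THEN iffD1, rotated -1]) (auto simp: indicator_def)
qed

text \<open>
  \<open>L1loc\<close> speaks of compact sets only, and the whole space is exhausted by balls.
\<close>

lemma L1loc_measurable:
  fixes v :: "'a::euclidean_space \<Rightarrow> real"
  assumes "v \<in> L1loc" shows "v \<in> borel_measurable lebesgue"
proof (rule borel_measurable_LIMSEQ_real)
  show "(\<lambda>x. indicator (cball 0 (real n)) x * v x) \<in> borel_measurable lebesgue" for n
    using L1loc_integrable_cball[OF assms] by (rule borel_measurable_integrable)
  show "(\<lambda>n. indicator (cball 0 (real n)) x * v x) \<longlonglongrightarrow> v x" for x
  proof (rule tendsto_eventually)
    obtain N where "norm x \<le> real N" using real_arch_simple by blast
    then show "\<forall>\<^sub>F n in sequentially. indicator (cball 0 (real n)) x * v x = v x"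
      by (auto simp: eventually_sequentially intro!: exI[of _ N])
  qed
qed

lemma integrable_bounded_inner_compact_support:
  fixes p k :: "'a::euclidean_space \<Rightarrow> 'e::euclidean_space"
  assumes S: "S \<in> sets lebesgue" and p: "p \<in> borel_measurable (lebesgue_on S)"
    and bound: "AE z in lebesgue_on S. norm (p z) \<le> C"
    and k: "continuous_on UNIV k" and A: "compact A" "\<And>z. z \<notin> A \<Longrightarrow> k z = 0"
  shows "integrable (lebesgue_on S) (\<lambda>z. p z \<bullet> k z)"
proof -
  obtain D where D: "\<And>z. z \<in> A \<Longrightarrow> norm (k z) \<le> D"
    using compact_imp_bounded[OF compact_continuous_image[OF continuous_on_subset[OF k] A(1)]]
    by (auto simp: bounded_iff)
  have D': "norm (k z) \<le> max 0 D" for z using D[of z] A(2)[of z] by fastforce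
  have AS: "A \<inter> S \<in> sets lebesgue" using S fmeasurableD[OF lmeasurable_compact[OF A(1)]] by (intro sets.Int)
  have mk: "k \<in> borel_measurable (lebesgue_on S)"
    by (intro measurable_restrict_space1 measurable_completion)
       (simp add: borel_measurable_continuous_onI k)
  show ?thesis
  proof (rule integrableI_bounded_set[where A = "A \<inter> S" and B = "\<bar>C\<bar> * max 0 D"])
    show "A \<inter> S \<in> sets (lebesgue_on S)"
      using AS S by (auto simp: sets_restrict_space)
    show "(\<lambda>z. p z \<bullet> k z) \<in> borel_measurable (lebesgue_on S)"
      using p mk by measurable
    have "emeasure (lebesgue_on S) (A \<inter> S) = emeasure lebesgue (A \<inter> S)"
      using S by (intro emeasure_restrict_space) auto
    also have "\<dots> \<le> emeasure lebesgue A"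
      using fmeasurableD[OF lmeasurable_compact[OF A(1)]] by (intro emeasure_mono) auto
    also have "\<dots> < \<infinity>"
      using lmeasurable_compact[OF A(1)] unfolding fmeasurable_def by blast
    finally show "emeasure (lebesgue_on S) (A \<inter> S) < \<infinity>" .
    show "AE z in lebesgue_on S. z \<in> A \<inter> S \<longrightarrow> norm (p z \<bullet> k z) \<le> \<bar>C\<bar> * max 0 D"
      using bound
    proof eventually_elim
      case (elim z)
      have "norm (p z \<bullet> k z) \<le> norm (p z) * norm (k z)" using Cauchy_Schwarz_ineq2 by simp
      also have "\<dots> \<le> \<bar>C\<bar> * max 0 D" using elim D'[of z] by (intro mult_mono) auto
      finally show ?case by simp
    qed
    show "AE z in lebesgue_on S. z \<notin> A \<inter> S \<longrightarrow> p z \<bullet> k z = 0"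
      using A(2) by (intro AE_I2) (auto simp: space_restrict_space)
  qed
qed

section \<open>Decay of a convex entropy\<close>

text \<open>
  The hypothesis \<open>flux\<close> is finite speed of propagation: entropy flows through space at speed at most \<open>M\<close>.
\<close>

locale bounded_entropy_evolution =
  fixes u :: "real \<Rightarrow> 'v::euclidean_space \<Rightarrow> real" and \<eta> :: "real \<Rightarrow> real" and q :: "real \<Rightarrow> 'v"
    and B M L :: real
  assumes jointly_measurable: "(\<lambda>(t, x). u t x) \<in> borel_measurable (lebesgue_on ({0<..} \<times> UNIV))"
    and bounded: "AE z in lebesgue_on ({0<..} \<times> UNIV). \<bar>u (fst z) (snd z)\<bar> \<le> B"
    and locally_integrable: "0 \<le> t \<Longrightarrow> u t \<in> L1loc"
    and L1_continuous: "compact K \<Longrightarrow> 0 \<le> t \<Longrightarrow>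
      ((\<lambda>s. LINT x:K|lebesgue. \<bar>u s x - u t x\<bar>) \<longlongrightarrow> 0) (at t within {0..})"
    and entropy: "entropy_inequality \<eta> q u"
    and \<eta>_0: "\<eta> 0 = 0" and \<eta>_nonneg: "0 \<le> \<eta> v"
    and \<eta>_lipschitz: "\<bar>\<eta> v - \<eta> w\<bar> \<le> L * \<bar>v - w\<bar>"
    and continuous_q: "continuous_on UNIV q"
    and flux: "\<bar>v\<bar> \<le> B \<Longrightarrow> norm (q v) \<le> M * \<eta> v"
    and M_nonneg: "0 \<le> M" and L_nonneg: "0 \<le> L"
begin

text \<open>
  The region \<open>cone_depth R t x > 0\<close> is a ball that shrinks in time, at least at speed \<open>M\<close>: on it \<open>\<bar>x\<bar> \<le> R\<close>, so the
  spatial gradient has length at most \<open>2 R\<close>, while the time derivative is \<open>- 2 M R\<close>. The square of \<open>\<bar>x\<bar>\<close>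
  in place of \<open>\<bar>x\<bar>\<close> makes it smooth.
\<close>

definition cone_depth :: "real \<Rightarrow> real \<Rightarrow> 'v \<Rightarrow> real" where
  "cone_depth R t x = R\<^sup>2 - x \<bullet> x - 2 * M * R * t"

definition weight :: "real \<Rightarrow> real \<Rightarrow> 'v \<Rightarrow> real" where
  "weight R t x = flat 1 (cone_depth R t x)"

definition local_entropy :: "real \<Rightarrow> real \<Rightarrow> real" where
  "local_entropy R t = (LINT x|lebesgue. \<eta> (u t x) * weight R t x)"

lemma continuous_\<eta>: "continuous_on UNIV \<eta>"
proof (rule lipschitz_on_continuous_on)
  show "L-lipschitz_on UNIV \<eta>"
    using \<eta>_lipschitz L_nonneg by (auto simp: lipschitz_on_def dist_real_def)
qed

lemma \<eta>_le: "\<eta> v \<le> L * \<bar>v\<bar>"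
  using \<eta>_lipschitz[of v 0] \<eta>_0 by simp

lemma weight_bounds: "0 \<le> weight R t x" "weight R t x \<le> 1"
  by (simp_all add: weight_def flat_one_nonneg flat_one_le_1)

lemma cone_depth_pos_imp: "0 \<le> R \<Longrightarrow> 0 \<le> t \<Longrightarrow> 0 < cone_depth R t x \<Longrightarrow> norm x \<le> R"
proof -
  assume "0 \<le> R" "0 \<le> t" "0 < cone_depth R t x"
  moreover have "0 \<le> 2 * M * R * t" using \<open>0 \<le> R\<close> \<open>0 \<le> t\<close> M_nonneg by simp
  ultimately have "(norm x)\<^sup>2 \<le> R\<^sup>2" by (simp add: cone_depth_def power2_norm_eq_inner)
  then show ?thesis using \<open>0 \<le> R\<close> by (rule power2_le_imp_le)
qed

lemma weight_eq_0: "0 \<le> R \<Longrightarrow> 0 \<le> t \<Longrightarrow> x \<notin> cball 0 R \<Longrightarrow> weight R t x = 0"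
  using cone_depth_pos_imp[of R t x] by (auto simp: weight_def flat_def)

lemma weight_measurable: "weight R t \<in> borel_measurable lebesgue"
proof -
  have "continuous_on UNIV (weight R t)"
    unfolding weight_def cone_depth_def
    by (intro continuous_on_compose2[OF continuous_flat[of UNIV]] continuous_intros) auto
  then show ?thesis by (intro measurable_completion) (simp add: borel_measurable_continuous_onI)
qed

lemma density_measurable:
  assumes "0 \<le> t" shows "(\<lambda>x. \<eta> (u t x)) \<in> borel_measurable lebesgue"
  using measurable_compose[OF L1loc_measurable[OF locally_integrable[OF assms]]
      borel_measurable_continuous_onI[OF continuous_\<eta>]] .

lemma weighted_measurable:
  "0 \<le> t \<Longrightarrow> (\<lambda>x. \<eta> (u t x) * weight R t x) \<in> borel_measurable lebesgue"
  by (intro borel_measurable_times density_measurable weight_measurable)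

lemma weighted_integrable:
  assumes "0 \<le> R" "0 \<le> t"
  shows "integrable lebesgue (\<lambda>x. \<eta> (u t x) * weight R t x)"
proof (rule Bochner_Integration.integrable_bound)
  show "integrable lebesgue (\<lambda>x. L * \<bar>indicator (cball 0 R) x * u t x\<bar>)"
    by (intro integrable_mult_right integrable_abs L1loc_integrable_cball locally_integrable assms)
  show "AE x in lebesgue. norm (\<eta> (u t x) * weight R t x) \<le> norm (L * \<bar>indicator (cball 0 R) x * u t x\<bar>)"
  proof (intro AE_I2)
    fix x
    have "\<eta> (u t x) * weight R t x \<le> L * \<bar>u t x\<bar> * 1"
      by (intro mult_mono \<eta>_le weight_bounds mult_nonneg_nonneg L_nonneg) auto
    then show "norm (\<eta> (u t x) * weight R t x) \<le> norm (L * \<bar>indicator (cball 0 R) x * u t x\<bar>)"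
      using weight_eq_0[OF assms, of x] \<eta>_nonneg weight_bounds(1) L_nonneg
      by (cases "x \<in> cball 0 R") (auto simp: abs_mult)
  qed
qed (rule weighted_measurable[OF assms(2)])

lemma weight_increment: "0 \<le> R \<Longrightarrow> \<bar>weight R s x - weight R t x\<bar> \<le> 4 * M * R * \<bar>s - t\<bar>"
proof -
  assume "0 \<le> R"
  have "cone_depth R s x - cone_depth R t x = 2 * M * R * (t - s)" by (simp add: cone_depth_def algebra_simps)
  then have "\<bar>cone_depth R s x - cone_depth R t x\<bar> = 2 * M * R * \<bar>s - t\<bar>"
    using M_nonneg \<open>0 \<le> R\<close> by (simp add: abs_mult abs_minus_commute)
  then show ?thesis
    using flat_one_lipschitz[of "cone_depth R s x" "cone_depth R t x"] by (simp add: weight_def)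
qed

text \<open>
  The change in \<open>u\<close> is controlled by its continuity in \<open>L\<^sup>1\<close> on the ball of radius \<open>R\<close>, since \<open>\<eta>\<close> is
  Lipschitz; the change in the weight is controlled by its Lipschitz continuity in time.
\<close>

lemma continuous_local_entropy:
  assumes "0 \<le> R" shows "continuous_on {0..} (local_entropy R)"
  unfolding continuous_on_def
proof
  fix t :: real assume "t \<in> {0..}"
  then have t: "0 \<le> t" by simp
  let ?K = "cball (0::'v) R"
  let ?c = "LINT x|lebesgue. \<bar>indicator ?K x * u t x\<bar>"
  let ?bound = "\<lambda>s. L * (LINT x:?K|lebesgue. \<bar>u s x - u t x\<bar>) + L * (4 * M * R * \<bar>s - t\<bar>) * ?c"
  have bound: "norm (local_entropy R s - local_entropy R t) \<le> ?bound s" if s: "0 \<le> s" for s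
  proof -
    have diff: "integrable lebesgue (\<lambda>x. indicator ?K x * \<bar>u s x - u t x\<bar>)"
      by (intro L1loc_integrable_abs_diff locally_integrable s t)
    have abs: "integrable lebesgue (\<lambda>x. \<bar>indicator ?K x * u t x\<bar>)"
      by (intro integrable_abs L1loc_integrable_cball locally_integrable t)
    have "norm (local_entropy R s - local_entropy R t) =
        norm (LINT x|lebesgue. \<eta> (u s x) * weight R s x - \<eta> (u t x) * weight R t x)"
      unfolding local_entropy_def
      by (subst Bochner_Integration.integral_diff) (auto intro: weighted_integrable assms s t)
    also have "\<dots> \<le> (LINT x|lebesgue. L * (indicator ?K x * \<bar>u s x - u t x\<bar>) +
        L * (4 * M * R * \<bar>s - t\<bar>) * \<bar>indicator ?K x * u t x\<bar>)"
    proof (rule order_trans[OF integral_norm_bound], rule integral_mono)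
      show "integrable lebesgue (\<lambda>x. norm (\<eta> (u s x) * weight R s x - \<eta> (u t x) * weight R t x))"
        by (intro integrable_norm Bochner_Integration.integrable_diff weighted_integrable assms s t)
      show "integrable lebesgue (\<lambda>x. L * (indicator ?K x * \<bar>u s x - u t x\<bar>) +
          L * (4 * M * R * \<bar>s - t\<bar>) * \<bar>indicator ?K x * u t x\<bar>)"
        by (intro Bochner_Integration.integrable_add integrable_mult_right diff abs)
      fix x
      show "norm (\<eta> (u s x) * weight R s x - \<eta> (u t x) * weight R t x) \<le>
          L * (indicator ?K x * \<bar>u s x - u t x\<bar>) + L * (4 * M * R * \<bar>s - t\<bar>) * \<bar>indicator ?K x * u t x\<bar>"
      proof (cases "x \<in> ?K")
        case True
        have "\<eta> (u s x) * weight R s x - \<eta> (u t x) * weight R t x =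
            (\<eta> (u s x) - \<eta> (u t x)) * weight R s x + \<eta> (u t x) * (weight R s x - weight R t x)"
          by (simp add: algebra_simps)
        also have "\<bar>\<dots>\<bar> \<le> \<bar>\<eta> (u s x) - \<eta> (u t x)\<bar> * weight R s x + \<eta> (u t x) * \<bar>weight R s x - weight R t x\<bar>"
          using abs_triangle_ineq[of "(\<eta> (u s x) - \<eta> (u t x)) * weight R s x"
              "\<eta> (u t x) * (weight R s x - weight R t x)"] weight_bounds(1) \<eta>_nonneg
          by (simp add: abs_mult)
        also have "\<dots> \<le> (L * \<bar>u s x - u t x\<bar>) * 1 + (L * \<bar>u t x\<bar>) * (4 * M * R * \<bar>s - t\<bar>)"
          by (intro add_mono mult_mono \<eta>_lipschitz weight_bounds \<eta>_le weight_increment assms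
              mult_nonneg_nonneg L_nonneg) auto
        finally show ?thesis using True by (simp add: mult_ac)
      next
        case False
        then show ?thesis using weight_eq_0 assms s t by simp
      qed
    qed
    also have "\<dots> = ?bound s"
      using diff abs by (subst Bochner_Integration.integral_add) (auto simp: set_lebesgue_integral_def)
    finally show ?thesis .
  qed
  have "((\<lambda>s. local_entropy R s - local_entropy R t) \<longlongrightarrow> 0) (at t within {0..})"
  proof (rule Lim_null_comparison)
    show "\<forall>\<^sub>F s in at t within {0..}. norm (local_entropy R s - local_entropy R t) \<le> ?bound s"
      using bound by (auto simp: eventually_at_filter)
    have "(?bound \<longlongrightarrow> L * 0 + L * (4 * M * R * \<bar>t - t\<bar>) * ?c) (at t within {0..})"
      by (intro tendsto_intros L1_continuous t) auto
    then show "(?bound \<longlongrightarrow> 0) (at t within {0..})" by simp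
  qed
  then show "(local_entropy R \<longlongrightarrow> local_entropy R t) (at t within {0..})"
    by (simp add: LIM_zero_iff)
qed

lemma cone_depth_at_top: "filterlim (\<lambda>n. cone_depth (real n) t x) at_top sequentially"
proof -
  have "filterlim (\<lambda>n. - (x \<bullet> x) + real n * (- 2 * M * t + real n)) at_top sequentially"
    by (intro filterlim_tendsto_add_at_top[OF tendsto_const] filterlim_at_top_mult_at_top
        filterlim_real_sequentially)
  then show ?thesis by (simp add: cone_depth_def power2_eq_square algebra_simps)
qed

lemma weight_tendsto_1: "(\<lambda>n. weight (real n) t x) \<longlonglongrightarrow> 1"
proof -
  have "((\<lambda>y::real. exp (- inverse y)) \<longlongrightarrow> exp (- 0)) at_top"
    by (intro tendsto_intros tendsto_inverse_0_at_top filterlim_ident)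
  moreover have "\<forall>\<^sub>F y in at_top. exp (- inverse y) = flat 1 y"
    using eventually_gt_at_top[of 0] by eventually_elim (simp add: flat_def inverse_eq_divide)
  ultimately have "(flat 1 \<longlongrightarrow> 1) at_top"
    using Lim_transform_eventually by fastforce
  from filterlim_compose[OF this cone_depth_at_top] show ?thesis by (simp add: weight_def)
qed

lemma test_function:
  assumes "0 \<le> R" "0 < a" "\<And>k. k_smooth k \<theta>" "\<And>\<tau>. 0 \<le> \<theta> \<tau>" "\<And>\<tau>. \<tau> \<notin> {a..b} \<Longrightarrow> \<theta> \<tau> = 0"
  shows "(\<lambda>z. \<theta> (fst z) * weight R (fst z) (snd z)) \<in> test_functions"
proof -
  let ?\<phi> = "\<lambda>z. \<theta> (fst z) * weight R (fst z) (snd z)"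
  let ?A = "{a..b} \<times> cball (0::'v) R"
  have supp: "{z. ?\<phi> z \<noteq> 0} \<subseteq> ?A"
  proof
    fix z assume "z \<in> {z. ?\<phi> z \<noteq> 0}"
    then have "\<theta> (fst z) \<noteq> 0" and w: "weight R (fst z) (snd z) \<noteq> 0" by auto
    then have "fst z \<in> {a..b}" using assms(5) by blast
    moreover from this have "snd z \<in> cball 0 R" using w weight_eq_0[of R "fst z" "snd z"] assms(1,2) by fastforce
    ultimately show "z \<in> ?A" by (simp add: mem_Times_iff)
  qed
  have "compact ?A" by (intro compact_Times) auto
  then have "closure {z. ?\<phi> z \<noteq> 0} \<subseteq> ?A" and bdd: "bounded {z. ?\<phi> z \<noteq> 0}"
    using closure_minimal[OF supp compact_imp_closed] bounded_subset[OF compact_imp_bounded supp]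
    by auto
  moreover have "?A \<subseteq> {0<..} \<times> UNIV" using assms(2) by auto
  moreover have sq: "k_smooth k (\<lambda>z::real \<times> 'v. (- 1) * (snd z \<bullet> snd z))" for k
  proof (cases k)
    case 0
    then show ?thesis by (auto intro!: continuous_intros)
  next
    case (Suc j)
    have "((\<lambda>z::real \<times> 'v. (- 1) * (snd z \<bullet> snd z)) has_derivative (\<lambda>v. - 2 * (snd z \<bullet> snd v))) (at z)" for z
      by (auto intro!: derivative_eq_intros simp: inner_commute)
    moreover have "k_smooth j (\<lambda>z::real \<times> 'v. - 2 * (snd z \<bullet> snd v))" for v
      by (intro k_smooth_bounded_linear bounded_linear_intros)
    ultimately show ?thesis unfolding Suc by (rule k_smooth_SucI)
  qed
  have "k_smooth k (\<lambda>z::real \<times> 'v. (R\<^sup>2 + (- 1) * (snd z \<bullet> snd z)) + (- 2 * M * R) * fst z)" for k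
    by (intro k_smooth_add k_smooth_mult k_smooth_const sq k_smooth_bounded_linear[OF bounded_linear_fst])
  then have "k_smooth k (\<lambda>z::real \<times> 'v. cone_depth R (fst z) (snd z))" for k
    by (simp add: cone_depth_def)
  then have "smooth ?\<phi>"
    unfolding smooth_def weight_def
    by (intro allI k_smooth_mult k_smooth_compose[OF assms(3)] k_smooth_compose[OF smooth_flat]
        k_smooth_bounded_linear[OF bounded_linear_fst])
  ultimately show ?thesis
    using assms(4) weight_bounds(1) by (auto simp: test_functions_def)
qed

lemma test_function_derivative:
  fixes R :: real and \<theta> \<theta>' :: "real \<Rightarrow> real"
  assumes \<theta>: "\<And>\<tau>. (\<theta> has_real_derivative \<theta>' \<tau>) (at \<tau>)"
  defines "\<omega>' \<equiv> \<lambda>t x. flat [:0, 0, 1:] (cone_depth R t x)"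
  shows "frechet_derivative (\<lambda>z. \<theta> (fst z) * weight R (fst z) (snd z)) (at (t, x)) (h, v) =
    (\<theta>' t * weight R t x - 2 * M * R * \<theta> t * \<omega>' t x) * h - 2 * \<theta> t * \<omega>' t x * (x \<bullet> v)"
proof -
  let ?z = "(t, x)"
  have "((\<lambda>z. \<theta> (fst z)) has_derivative (\<lambda>k. \<theta>' t * fst k)) (at ?z)"
    using has_derivative_compose[OF has_derivative_fst[OF has_derivative_ident]
        \<theta>[unfolded has_field_derivative_def, of "fst ?z"]] by simp
  moreover have "((\<lambda>z. cone_depth R (fst z) (snd z)) has_derivative (\<lambda>k. - 2 * (x \<bullet> snd k) - 2 * M * R * fst k)) (at ?z)"
    unfolding cone_depth_def by (auto intro!: derivative_eq_intros simp: inner_commute)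
  then have "((\<lambda>z. weight R (fst z) (snd z)) has_derivative
      (\<lambda>k. \<omega>' t x * (- 2 * (x \<bullet> snd k) - 2 * M * R * fst k))) (at ?z)"
    unfolding weight_def \<omega>'_def
    using has_derivative_compose[OF _ flat_one_has_derivative[unfolded has_field_derivative_def],
        of "\<lambda>z. cone_depth R (fst z) (snd z)" _ ?z UNIV] by simp
  ultimately have "((\<lambda>z. \<theta> (fst z) * weight R (fst z) (snd z)) has_derivative
      (\<lambda>k. \<theta> t * (\<omega>' t x * (- 2 * (x \<bullet> snd k) - 2 * M * R * fst k)) + (\<theta>' t * fst k) * weight R t x)) (at ?z)"
    using has_derivative_mult by fastforce
  from frechet_derivative_at[OF this, symmetric] show ?thesis
    by (simp add: algebra_simps)
qed

text \<open>
  In the entropy inequality with test function \<open>\<theta>(t) w(t,x)\<close>, the terms without \<open>\<theta>'\<close> add up to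
  \<open>- 2 \<theta> \<omega>' (M R \<eta>(u) + x \<bullet> q(u))\<close>, where \<open>\<omega>'\<close> is the derivative of \<open>flat 1\<close> at the cone depth. This is
  nonpositive by \<open>flux\<close>, because \<open>\<bar>x\<bar> \<le> R\<close> wherever \<open>\<omega>'\<close> does not vanish.
\<close>

lemma local_entropy_decreasing_weakly:
  fixes \<theta> \<theta>' :: "real \<Rightarrow> real"
  assumes "0 \<le> R" "0 < a"
    and smooth: "\<And>k. k_smooth k \<theta>" and cont: "continuous_on UNIV \<theta>'"
    and deriv: "\<And>\<tau>. (\<theta> has_real_derivative \<theta>' \<tau>) (at \<tau>)" and nonneg: "\<And>\<tau>. 0 \<le> \<theta> \<tau>"
    and supp: "\<And>\<tau>. \<tau> \<notin> {a..b} \<Longrightarrow> \<theta> \<tau> = 0 \<and> \<theta>' \<tau> = 0"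
  shows "0 \<le> (LINT \<tau>:{0<..}|lborel. local_entropy R \<tau> * \<theta>' \<tau>)"
proof -
  define S :: "(real \<times> 'v) set" where "S = {0<..} \<times> UNIV"
  define A :: "(real \<times> 'v) set" where "A = {a..b} \<times> cball 0 R"
  let ?W = "lebesgue_on S"
  define U where "U = (\<lambda>z. u (fst z) (snd z))"
  define \<omega> where "\<omega> z = weight R (fst z) (snd z)" for z
  define \<omega>' where "\<omega>' z = flat [:0, 0, 1:] (cone_depth R (fst z) (snd z))" for z
  define k1 where "k1 z = \<theta>' (fst z) * \<omega> z - 2 * M * R * \<theta> (fst z) * \<omega>' z" for z
  define k2 where "k2 z = (- 2 * \<theta> (fst z) * \<omega>' z) *\<^sub>R snd z" for z
  define k3 where "k3 z = \<theta>' (fst z) * \<omega> z" for z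
  have S: "S \<in> sets lebesgue" unfolding S_def by (intro borel_open sets_completionI_sets) (auto simp: open_Times)
  have cont_\<theta>: "continuous_on UNIV \<theta>" using smooth[of 0] by simp
  have cont_depth: "continuous_on UNIV (\<lambda>z. cone_depth R (fst z) (snd z))"
    unfolding cone_depth_def by (intro continuous_intros)
  have cont_\<omega>: "continuous_on UNIV \<omega>" and cont_\<omega>': "continuous_on UNIV \<omega>'"
    unfolding \<omega>_def weight_def \<omega>'_def
    by (auto intro: continuous_on_compose2[OF continuous_flat[of UNIV] cont_depth])
  have cont_k: "continuous_on UNIV k1" "continuous_on UNIV k2" "continuous_on UNIV k3"
    unfolding k1_def k2_def k3_def
    by (intro continuous_intros cont_\<omega> cont_\<omega>' continuous_on_compose2[OF cont_\<theta>]
        continuous_on_compose2[OF cont]; simp)+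
  have "compact A" unfolding A_def by (intro compact_Times) auto
  have supp_k: "k1 z = 0" "k2 z = 0" "k3 z = 0" if "z \<notin> A" for z
  proof -
    have "(\<theta> (fst z) = 0 \<and> \<theta>' (fst z) = 0) \<or> (\<omega> z = 0 \<and> \<omega>' z = 0)"
    proof (cases "fst z \<in> {a..b}")
      case True
      with that have "\<not> norm (snd z) \<le> R" by (auto simp: A_def mem_Times_iff)
      then have "\<not> 0 < cone_depth R (fst z) (snd z)"
        using cone_depth_pos_imp[of R "fst z" "snd z"] assms(1,2) True by auto
      then show ?thesis by (simp add: \<omega>_def \<omega>'_def weight_def flat_def)
    qed (use supp in auto)
    then show "k1 z = 0" "k2 z = 0" "k3 z = 0" by (auto simp: k1_def k2_def k3_def)
  qed
  have U: "U \<in> borel_measurable ?W"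
    using jointly_measurable by (simp add: U_def S_def case_prod_beta')
  have \<eta>U: "(\<lambda>z. \<eta> (U z)) \<in> borel_measurable ?W" and qU: "(\<lambda>z. q (U z)) \<in> borel_measurable ?W"
    using measurable_compose[OF U borel_measurable_continuous_onI[OF continuous_\<eta>]]
      measurable_compose[OF U borel_measurable_continuous_onI[OF continuous_q]] .
  have U_bound: "AE z in ?W. \<bar>U z\<bar> \<le> B" using bounded unfolding U_def S_def .
  have \<eta>U_bound: "AE z in ?W. norm (\<eta> (U z)) \<le> L * B" using U_bound
  proof eventually_elim
    case (elim z)
    then show ?case
      using \<eta>_le[of "U z"] \<eta>_nonneg[of "U z"] mult_left_mono[OF elim L_nonneg] by simp
  qed
  then have qU_bound: "AE z in ?W. norm (q (U z)) \<le> M * (L * B)" using U_bound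
  proof eventually_elim
    case (elim z)
    then show ?case
      using flux[OF elim(2)] mult_left_mono[OF elim(1) M_nonneg] \<eta>_nonneg[of "U z"] by simp
  qed
  \<comment> \<open>The Bochner integral of a non-integrable function is 0, and the entropy inequality would be void.\<close>
  note int = integrable_bounded_inner_compact_support[OF S _ _ _ \<open>compact A\<close>]
  have int_G: "integrable ?W (\<lambda>z. \<eta> (U z) \<bullet> k1 z + q (U z) \<bullet> k2 z)"
    by (intro Bochner_Integration.integrable_add int[OF \<eta>U \<eta>U_bound cont_k(1) supp_k(1)]
        int[OF qU qU_bound cont_k(2) supp_k(2)])
  have int_H: "integrable ?W (\<lambda>z. \<eta> (U z) \<bullet> k3 z)"
    by (rule int[OF \<eta>U \<eta>U_bound cont_k(3) supp_k(3)])
  have inner: "(LINT x|lebesgue. indicator S (t, x) *\<^sub>R (\<eta> (U (t, x)) \<bullet> k3 (t, x))) =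
      indicator {0<..} t *\<^sub>R (local_entropy R t * \<theta>' t)" for t
  proof (cases "0 < t")
    case True
    have "(LINT x|lebesgue. indicator S (t, x) *\<^sub>R (\<eta> (U (t, x)) \<bullet> k3 (t, x))) =
        (LINT x|lebesgue. \<theta>' t * (\<eta> (u t x) * weight R t x))"
      using True by (intro Bochner_Integration.integral_cong) (auto simp: S_def U_def k3_def \<omega>_def)
    then show ?thesis using True by (simp add: local_entropy_def)
  qed (simp add: S_def)
  have "(\<lambda>z. \<theta> (fst z) * weight R (fst z) (snd z)) \<in> test_functions"
    using test_function[OF assms(1,2) smooth nonneg] supp by blast
  from bspec[OF entropy[unfolded entropy_inequality_def] this]
  have "0 \<le> (LINT (t, x)|?W.
      \<eta> (u t x) * frechet_derivative (\<lambda>z. \<theta> (fst z) * weight R (fst z) (snd z)) (at (t, x)) (1, 0) +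
      frechet_derivative (\<lambda>z. \<theta> (fst z) * weight R (fst z) (snd z)) (at (t, x)) (0, q (u t x)))"
    unfolding S_def .
  also have "\<dots> = (LINT z|?W. \<eta> (U z) \<bullet> k1 z + q (U z) \<bullet> k2 z)"
    by (rule Bochner_Integration.integral_cong)
       (auto simp: test_function_derivative[OF deriv] U_def k1_def k2_def \<omega>_def \<omega>'_def inner_commute)
  also have "\<dots> \<le> (LINT z|?W. \<eta> (U z) \<bullet> k3 z)"
  proof (rule integral_mono_AE[OF int_G int_H])
    have "AE z in ?W. z \<in> S" by (rule AE_I2) (simp add: space_restrict_space)
    then show "AE z in ?W. \<eta> (U z) \<bullet> k1 z + q (U z) \<bullet> k2 z \<le> \<eta> (U z) \<bullet> k3 z" using U_bound
    proof eventually_elim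
      case (elim z)
      have "0 \<le> \<omega>' z * (M * \<eta> (U z) * R + q (U z) \<bullet> snd z)"
      proof (cases "0 < cone_depth R (fst z) (snd z)")
        case True
        then have "norm (snd z) \<le> R" using cone_depth_pos_imp[of R "fst z" "snd z"] assms(1) elim(1) by (auto simp: S_def)
        then have "norm (q (U z)) * norm (snd z) \<le> M * \<eta> (U z) * R"
          using flux[OF elim(2)] by (intro mult_mono) (auto intro: mult_nonneg_nonneg M_nonneg \<eta>_nonneg)
        then have "0 \<le> M * \<eta> (U z) * R + q (U z) \<bullet> snd z"
          using Cauchy_Schwarz_ineq2[of "q (U z)" "snd z"] by linarith
        then show ?thesis by (simp add: \<omega>'_def flat_deriv_nonneg)
      qed (simp add: \<omega>'_def flat_def)
      then have "0 \<le> 2 * \<theta> (fst z) * (\<omega>' z * (M * \<eta> (U z) * R + q (U z) \<bullet> snd z))"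
        using nonneg by simp
      then show ?case by (simp add: k1_def k2_def k3_def algebra_simps)
    qed
  qed
  also have "\<dots> = (LINT z|lebesgue. indicator S z *\<^sub>R (\<eta> (U z) \<bullet> k3 z))"
    using S by (intro integral_restrict_space) auto
  also have "\<dots> = (LINT t|lborel. LINT x|lebesgue. indicator S (t, x) *\<^sub>R (\<eta> (U (t, x)) \<bullet> k3 (t, x)))"
  proof -
    show ?thesis
    proof (rule Fubini_lebesgue)
      show "integrable lebesgue (\<lambda>z. indicator S z *\<^sub>R (\<eta> (U z) \<bullet> k3 z))"
        using int_H S by (subst integrable_restrict_space[symmetric]) auto
      show "(\<lambda>x. indicator S (t, x) *\<^sub>R (\<eta> (U (t, x)) \<bullet> k3 (t, x))) \<in> borel_measurable lebesgue" for t
      proof (cases "0 < t")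
        case True
        have "(\<lambda>x. \<theta>' t * (\<eta> (u t x) * weight R t x)) \<in> borel_measurable lebesgue"
          using True by (intro borel_measurable_times weighted_measurable) auto
        then show ?thesis using True by (simp add: S_def U_def k3_def \<omega>_def mult_ac)
      qed (simp add: S_def)
      have "continuous_on {0<..} (\<lambda>t. local_entropy R t * \<theta>' t)"
        using continuous_local_entropy[OF assms(1)] cont
        by (intro continuous_on_mult) (auto elim: continuous_on_subset)
      then have "(\<lambda>t. indicator {0<..} t *\<^sub>R (local_entropy R t * \<theta>' t)) \<in> borel_measurable borel"
        by (intro borel_measurable_continuous_on_indicator) auto
      then show "(\<lambda>t. LINT x|lebesgue. indicator S (t, x) *\<^sub>R (\<eta> (U (t, x)) \<bullet> k3 (t, x))) \<in> borel_measurable lborel"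
        unfolding inner by simp
    qed
  qed
  also have "\<dots> = (LINT \<tau>:{0<..}|lborel. local_entropy R \<tau> * \<theta>' \<tau>)"
    by (simp only: inner set_lebesgue_integral_def)
  finally show ?thesis .
qed

lemma local_entropy_antimono: "0 \<le> R \<Longrightarrow> antimono_on {0..} (local_entropy R)"
  by (rule antimono_on_if_derivative_le_0_weakly)
     (use continuous_local_entropy local_entropy_decreasing_weakly in blast)+

text \<open>
  Fatou's lemma as \<open>R \<rightarrow> \<infinity>\<close>, when the weights tend to \<open>1\<close> while staying below it.
\<close>

lemma entropy_decay:
  assumes "0 \<le> s" "s \<le> t"
  shows "(\<integral>\<^sup>+ x. ennreal (\<eta> (u t x)) \<partial>lebesgue) \<le> (\<integral>\<^sup>+ x. ennreal (\<eta> (u s x)) \<partial>lebesgue)"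
proof -
  have "0 \<le> t" using assms by simp
  have nn_eq: "(\<integral>\<^sup>+ x. ennreal (\<eta> (u p x) * weight (real n) p x) \<partial>lebesgue) = ennreal (local_entropy (real n) p)"
    if "0 \<le> p" for p n
    unfolding local_entropy_def
    by (intro nn_integral_eq_integral weighted_integrable that AE_I2 mult_nonneg_nonneg \<eta>_nonneg
        weight_bounds) auto
  have "(\<integral>\<^sup>+ x. ennreal (\<eta> (u t x)) \<partial>lebesgue) =
      (\<integral>\<^sup>+ x. liminf (\<lambda>n. ennreal (\<eta> (u t x) * weight (real n) t x)) \<partial>lebesgue)"
  proof (rule nn_integral_cong)
    fix x
    have "(\<lambda>n. ennreal (\<eta> (u t x) * weight (real n) t x)) \<longlonglongrightarrow> ennreal (\<eta> (u t x) * 1)"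
      by (intro tendsto_intros weight_tendsto_1)
    from lim_imp_Liminf[OF sequentially_bot this]
    show "ennreal (\<eta> (u t x)) = liminf (\<lambda>n. ennreal (\<eta> (u t x) * weight (real n) t x))"
      by simp
  qed
  also have "\<dots> \<le> liminf (\<lambda>n. \<integral>\<^sup>+ x. ennreal (\<eta> (u t x) * weight (real n) t x) \<partial>lebesgue)"
    by (intro nn_integral_liminf) (use weighted_measurable[OF \<open>0 \<le> t\<close>] in measurable)
  also have "\<dots> \<le> (\<integral>\<^sup>+ x. ennreal (\<eta> (u s x)) \<partial>lebesgue)"
  proof (rule Liminf_le[OF sequentially_bot always_eventually], rule allI)
    fix n
    have "local_entropy (real n) t \<le> local_entropy (real n) s"
      using monotone_onD[OF local_entropy_antimono[of "real n"], of s t] assms by simp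
    then have "(\<integral>\<^sup>+ x. ennreal (\<eta> (u t x) * weight (real n) t x) \<partial>lebesgue) \<le>
        (\<integral>\<^sup>+ x. ennreal (\<eta> (u s x) * weight (real n) s x) \<partial>lebesgue)"
      using nn_eq[OF assms(1)] nn_eq[OF \<open>0 \<le> t\<close>] by (simp add: ennreal_leI)
    also have "\<dots> \<le> (\<integral>\<^sup>+ x. ennreal (\<eta> (u s x)) \<partial>lebesgue)"
      by (intro nn_integral_mono ennreal_leI mult_left_le weight_bounds \<eta>_nonneg)
    finally show "(\<integral>\<^sup>+ x. ennreal (\<eta> (u t x) * weight (real n) t x) \<partial>lebesgue) \<le>
        (\<integral>\<^sup>+ x. ennreal (\<eta> (u s x)) \<partial>lebesgue)" .
  qed
  finally show ?thesis .
qed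

end

section \<open>Kruzhkov solutions\<close>

text \<open>
  The entropy flux is the antiderivative of \<open>\<eta>' f'\<close> that vanishes at \<open>0\<close>, the normalisation under which
  \<open>flux_bound\<close> holds.
\<close>

lemma huber_decay:
  fixes f :: "real \<Rightarrow> 'v::euclidean_space"
  assumes f: "smooth f" and u: "kruzhkov_solution f a u" and l: "0 \<le> l" and st: "0 \<le> s" "s \<le> t"
  shows "(\<integral>\<^sup>+ x. ennreal (huber l (u t x)) \<partial>lebesgue) \<le> (\<integral>\<^sup>+ x. ennreal (huber l (u s x)) \<partial>lebesgue)"
proof -
  let ?g = "\<lambda>s. vector_derivative f (at s)"
  have cont_g: "continuous_on UNIV ?g" by (rule smooth_imp_continuous_derivative[OF f])
  obtain q where q: "q 0 = 0" "\<And>s. (q has_vector_derivative (2 * trunc l s) *\<^sub>R ?g s) (at s)"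
    using antiderivative_exists[of "\<lambda>s. (2 * trunc l s) *\<^sub>R ?g s"]
      continuous_on_scaleR[OF continuous_on_mult[OF continuous_on_const continuous_trunc] cont_g]
    by blast
  have cont_q: "continuous_on UNIV q"
    using q(2) by (meson continuous_at_imp_continuous_on has_vector_derivative_continuous)
  have "m = 2 * trunc l s" if "(huber l has_real_derivative m) (at s)" for s m
    using DERIV_unique[OF that huber_has_derivative[OF l]] .
  then have pair: "entropy_pair f (huber l) q"
    unfolding entropy_pair_def using convex_huber[OF l] cont_q q(2) by blast
  obtain B where B: "AE z in lebesgue_on ({0<..} \<times> UNIV). \<bar>u (fst z) (snd z)\<bar> \<le> B"
    using u by (auto simp: kruzhkov_solution_def Linf_def case_prod_beta')
  have "compact (?g ` {- B..B})"
    by (intro compact_continuous_image continuous_on_subset[OF cont_g]) auto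
  then obtain M where "0 < M" and M': "\<forall>y\<in>?g ` {- B..B}. norm y \<le> M"
    using compact_imp_bounded bounded_pos by metis
  have M: "norm (?g s) \<le> M" if "\<bar>s\<bar> \<le> B" for s
    using M' that by (simp add: abs_le_iff)
  interpret bounded_entropy_evolution u "huber l" q B M "2 * l"
  proof
    show "norm (q v) \<le> M * huber l v" if "\<bar>v\<bar> \<le> B" for v
      by (rule flux_bound[OF q huber_0[OF l] huber_has_derivative[OF l] _ M that])
         (use l in \<open>auto simp: trunc_def zero_le_mult_iff\<close>)
    show "entropy_inequality (huber l) q u" using u pair by (simp add: kruzhkov_solution_def)
    show "(\<lambda>(t, x). u t x) \<in> borel_measurable (lebesgue_on ({0<..} \<times> UNIV))"
      using u by (simp add: kruzhkov_solution_def Linf_def)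
    show "u t \<in> L1loc" if "0 \<le> t" for t
      using u that by (simp add: kruzhkov_solution_def)
    show "((\<lambda>s. LINT x:K|lebesgue. \<bar>u s x - u t x\<bar>) \<longlongrightarrow> 0) (at t within {0..})"
      if "compact K" "0 \<le> t" for K t
      using u that unfolding kruzhkov_solution_def by blast
    show "AE z in lebesgue_on ({0<..} \<times> UNIV). \<bar>u (fst z) (snd z)\<bar> \<le> B" by (rule B)
    show "continuous_on UNIV q" by (rule cont_q)
    show "\<bar>huber l v - huber l w\<bar> \<le> 2 * l * \<bar>v - w\<bar>" for v w by (rule huber_lipschitz[OF l])
  qed (use l \<open>0 < M\<close> in \<open>simp_all add: huber_0 huber_nonneg\<close>)
  show ?thesis by (rule entropy_decay[OF st])
qed

text \<open>
  The bound on \<open>u\<close> as a function of \<open>(t,x)\<close> holds at almost every time. It passes to every \<open>t\<close> because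
  \<open>u t\<close> is an \<open>L\<^sup>1\<close> limit on balls of \<open>u \<tau>\<close> for such times \<open>\<tau>\<close>: there the excess of \<open>\<bar>u t\<bar>\<close> over \<open>B\<close> is
  at most \<open>\<bar>u \<tau> - u t\<bar>\<close>.
\<close>

lemma kruzhkov_solution_bounded:
  fixes f :: "real \<Rightarrow> 'v::euclidean_space"
  assumes u: "kruzhkov_solution f a u"
  obtains B where "\<And>t. 0 \<le> t \<Longrightarrow> AE x in lebesgue. \<bar>u t x\<bar> \<le> B"
proof -
  obtain B where "AE z in lebesgue_on ({0<..} \<times> UNIV). \<bar>u (fst z) (snd z)\<bar> \<le> B"
    using u by (auto simp: kruzhkov_solution_def Linf_def case_prod_beta')
  then have "AE z in lebesgue. z \<in> {0<..} \<times> UNIV \<longrightarrow> \<bar>u (fst z) (snd z)\<bar> \<le> B"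
  proof (subst AE_restrict_space_iff[symmetric])
    have "{0<..} \<times> UNIV \<in> sets (borel :: (real \<times> 'v) measure)"
      by (intro borel_open open_Times) auto
    then show "({0<..} \<times> UNIV) \<inter> space lebesgue \<in> sets (lebesgue :: (real \<times> 'v) measure)"
      by simp
  qed
  from AE_lebesgue_prod[OF this]
  have good: "AE \<tau> in lborel. 0 < \<tau> \<longrightarrow> (AE x in lebesgue. \<bar>u \<tau> x\<bar> \<le> B)"
    by (simp add: AE_completion_iff)
  have L1: "0 \<le> t \<Longrightarrow> u t \<in> L1loc" for t using u by (simp add: kruzhkov_solution_def)
  have "AE x in lebesgue. \<bar>u t x\<bar> \<le> B" if t: "0 \<le> t" for t
  proof -
    have ball: "AE x in lebesgue. x \<in> cball 0 (real n) \<longrightarrow> \<bar>u t x\<bar> \<le> B" for n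
    proof -
      let ?K = "cball (0::'v) (real n)"
      let ?h = "\<lambda>x. indicator ?K x * max 0 (\<bar>u t x\<bar> - B)"
      have diff: "integrable lebesgue (\<lambda>x. indicator ?K x * \<bar>u \<tau> x - u t x\<bar>)" if "0 \<le> \<tau>" for \<tau>
        by (intro L1loc_integrable_abs_diff L1 t that)
      have meas: "u \<tau> \<in> borel_measurable lebesgue" if "0 \<le> \<tau>" for \<tau>
        using L1loc_measurable[OF L1[OF that]] .
      have h_meas: "?h \<in> borel_measurable lebesgue"
        using meas[OF t] by (intro borel_measurable_times borel_measurable_max borel_measurable_diff
            borel_measurable_abs borel_measurable_indicator) auto
      have small: "integrable lebesgue ?h \<and> (LINT x|lebesgue. ?h x) \<le> \<epsilon>" if "0 < \<epsilon>" for \<epsilon>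
      proof -
        have "((\<lambda>s. LINT x:?K|lebesgue. \<bar>u s x - u t x\<bar>) \<longlongrightarrow> 0) (at t within {0..})"
          using u t by (simp add: kruzhkov_solution_def)
        then have "\<forall>\<^sub>F s in at t within {0..}. dist (LINT x:?K|lebesgue. \<bar>u s x - u t x\<bar>) 0 < \<epsilon>"
          using that by (rule tendstoD)
        then obtain d where "0 < d" and d: "\<And>s. 0 \<le> s \<Longrightarrow> s \<noteq> t \<Longrightarrow> dist s t < d \<Longrightarrow>
            dist (LINT x:?K|lebesgue. \<bar>u s x - u t x\<bar>) 0 < \<epsilon>"
          by (auto simp: eventually_at)
        have "\<exists>\<tau>\<in>{t<..<t + d}. AE x in lebesgue. \<bar>u \<tau> x\<bar> \<le> B"
        proof (rule ccontr)
          assume none: "\<not> ?thesis"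
          have "AE \<tau> in lborel. \<tau> \<notin> {t<..<t + d}"
            using good by eventually_elim (use none t in auto)
          then have "emeasure lborel {t<..<t + d} = 0"
            by (subst (asm) AE_iff_null_sets[symmetric]) auto
          then show False using \<open>0 < d\<close> by simp
        qed
        then obtain \<tau> where \<tau>: "t < \<tau>" "\<tau> < t + d" and bd: "AE x in lebesgue. \<bar>u \<tau> x\<bar> \<le> B"
          by auto
        then have "0 \<le> \<tau>" using t by simp
        have le: "AE x in lebesgue. ?h x \<le> indicator ?K x * \<bar>u \<tau> x - u t x\<bar>"
          using bd by eventually_elim (auto simp: indicator_def)
        have int: "integrable lebesgue ?h"
          by (rule Bochner_Integration.integrable_bound[OF diff[OF \<open>0 \<le> \<tau>\<close>] h_meas])
             (use le in eventually_elim, auto simp: indicator_def)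
        have "(LINT x|lebesgue. ?h x) \<le> (LINT x|lebesgue. indicator ?K x * \<bar>u \<tau> x - u t x\<bar>)"
          by (rule integral_mono_AE[OF int diff[OF \<open>0 \<le> \<tau>\<close>] le])
        also have "\<dots> < \<epsilon>"
          using d[OF \<open>0 \<le> \<tau>\<close>] \<tau> by (simp add: dist_real_def set_lebesgue_integral_def)
        finally show ?thesis using int by simp
      qed
      have "(LINT x|lebesgue. ?h x) \<le> 0"
        by (rule field_le_epsilon) (use small in auto)
      moreover have "0 \<le> (LINT x|lebesgue. ?h x)" by (intro integral_nonneg_AE AE_I2) simp
      ultimately have "(LINT x|lebesgue. ?h x) = 0" by simp
      then have "AE x in lebesgue. ?h x = 0"
        using integral_nonneg_eq_0_iff_AE[of lebesgue ?h] small[of 1] by simp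
      then show ?thesis by eventually_elim (auto simp: max_def split: if_splits)
    qed
    then have "AE x in lebesgue. \<forall>n. x \<in> cball 0 (real n) \<longrightarrow> \<bar>u t x\<bar> \<le> B"
      unfolding AE_all_countable by blast
    then show ?thesis
      by eventually_elim (use real_arch_simple in fastforce)
  qed
  then show ?thesis by (rule that)
qed

section \<open>Distance to the ball of \<open>L\<^sup>1\<close>\<close>

lemma nn_integral_abs_le_if_truncations_le:
  assumes v: "v \<in> borel_measurable M"
    and le: "\<And>l::real. 0 < l \<Longrightarrow> (\<integral>\<^sup>+ x. ennreal (max 0 (\<bar>v x\<bar> - l)) \<partial>M) \<le> r"
  shows "(\<integral>\<^sup>+ x. ennreal \<bar>v x\<bar> \<partial>M) \<le> r"
proof -
  have "(\<integral>\<^sup>+ x. ennreal \<bar>v x\<bar> \<partial>M) =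
      (\<integral>\<^sup>+ x. liminf (\<lambda>n. ennreal (max 0 (\<bar>v x\<bar> - inverse (real (Suc n))))) \<partial>M)"
  proof (rule nn_integral_cong)
    fix x
    have "(\<lambda>n. ennreal (max 0 (\<bar>v x\<bar> - inverse (real (Suc n))))) \<longlonglongrightarrow> ennreal (max 0 (\<bar>v x\<bar> - 0))"
      by (intro tendsto_intros LIMSEQ_inverse_real_of_nat)
    from lim_imp_Liminf[OF sequentially_bot this]
    show "ennreal \<bar>v x\<bar> = liminf (\<lambda>n. ennreal (max 0 (\<bar>v x\<bar> - inverse (real (Suc n)))))" by simp
  qed
  also have "\<dots> \<le> liminf (\<lambda>n. \<integral>\<^sup>+ x. ennreal (max 0 (\<bar>v x\<bar> - inverse (real (Suc n)))) \<partial>M)"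
    by (intro nn_integral_liminf) (use v in \<open>auto intro!: measurable_compose[OF _ measurable_ennreal]\<close>)
  also have "\<dots> \<le> r"
    by (intro Liminf_le[OF sequentially_bot] always_eventually allI le) simp
  finally show ?thesis .
qed

text \<open>
  The \<open>L\<^sup>1\<close> norm \<open>m l\<close> of the soft threshold is finite for \<open>l > 0\<close>, convex and hence continuous in \<open>l\<close>, and \<open>0\<close>
  once \<open>l\<close> exceeds the bound of \<open>v\<close>. Either it reaches \<open>r\<close> somewhere, or it stays below \<open>r\<close> down to \<open>l = 0\<close>,
  and then \<open>v\<close> itself has \<open>L\<^sup>1\<close> norm at most \<open>r\<close>. The last claim is complementary slackness.
\<close>

lemma soft_threshold_level:
  fixes v :: "'a \<Rightarrow> real"
  assumes v: "v \<in> borel_measurable M" and bound: "AE x in M. \<bar>v x\<bar> \<le> B"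
    and finite: "\<And>l. 0 < l \<Longrightarrow> (\<integral>\<^sup>+ x. ennreal (huber l (v x)) \<partial>M) < \<infinity>" and "0 < r"
  obtains l where "0 \<le> l" "(\<integral>\<^sup>+ x. ennreal \<bar>v x - trunc l (v x)\<bar> \<partial>M) \<le> ennreal r"
    "l = 0 \<or> (\<integral>\<^sup>+ x. ennreal \<bar>v x - trunc l (v x)\<bar> \<partial>M) = ennreal r"
proof -
  define e where "e l x = max 0 (\<bar>v x\<bar> - l)" for l x
  define m where "m l = (LINT x|M. e l x)" for l
  have e_meas: "e l \<in> borel_measurable M" for l unfolding e_def using v by measurable
  have int: "integrable M (e l)" if "0 < l" for l
  proof (rule integrableI_nonneg[OF e_meas])
    have "(\<integral>\<^sup>+ x. ennreal (e l x) \<partial>M) \<le> (\<integral>\<^sup>+ x. ennreal (1 / (2 * l)) * ennreal (huber l (v x)) \<partial>M)"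
    proof (rule nn_integral_mono)
      fix x
      have "2 * l * e l x \<le> huber l (v x)"
        using huber_soft_threshold[of l "v x"] abs_minus_trunc[of l "v x"] that by (simp add: e_def)
      then have "e l x \<le> (1 / (2 * l)) * huber l (v x)" using that by (simp add: field_simps)
      then show "ennreal (e l x) \<le> ennreal (1 / (2 * l)) * ennreal (huber l (v x))"
        using that by (simp add: ennreal_mult[symmetric] huber_nonneg ennreal_leI)
    qed
    also have "\<dots> = ennreal (1 / (2 * l)) * (\<integral>\<^sup>+ x. ennreal (huber l (v x)) \<partial>M)"
      using measurable_compose[OF v borel_measurable_continuous_onI[OF continuous_huber[of l]]] that
      by (intro nn_integral_cmult) (auto intro: measurable_compose[OF _ measurable_ennreal])
    also have "\<dots> < \<infinity>" using finite[OF that] by (simp add: ennreal_mult_less_top)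
    finally show "(\<integral>\<^sup>+ x. ennreal (e l x) \<partial>M) < \<infinity>" .
  qed (simp add: e_def)
  have nn_m: "(\<integral>\<^sup>+ x. ennreal (e l x) \<partial>M) = ennreal (m l)" if "0 < l" for l
    unfolding m_def by (intro nn_integral_eq_integral int that) (simp add: e_def)
  have e_eq: "\<bar>v x - trunc l (v x)\<bar> = e l x" if "0 \<le> l" for l x
    using abs_minus_trunc[OF that] by (simp add: e_def)
  show ?thesis
  proof (cases "\<exists>l0>0. r \<le> m l0")
    case True
    then obtain l0 where l0: "0 < l0" "r \<le> m l0" by blast
    have "convex_on {0<..} m"
    proof (rule convex_onI)
      fix t x y :: real assume t: "0 < t" "t < 1" and "x \<in> {0<..}" "y \<in> {0<..}"
      then have xy: "0 < x" "0 < y" "0 < (1 - t) * x + t * y" by (auto intro: add_pos_pos)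
      have "m ((1 - t) * x + t * y) \<le> (LINT z|M. (1 - t) * e x z + t * e y z)"
        unfolding m_def
      proof (rule integral_mono)
        fix z
        have "\<bar>v z\<bar> - ((1 - t) * x + t * y) = (1 - t) * (\<bar>v z\<bar> - x) + t * (\<bar>v z\<bar> - y)"
          by (simp add: algebra_simps)
        also have "\<dots> \<le> (1 - t) * e x z + t * e y z"
          using t by (intro add_mono mult_left_mono) (auto simp: e_def)
        finally show "e ((1 - t) * x + t * y) z \<le> (1 - t) * e x z + t * e y z"
          using t by (simp add: e_def)
      qed (intro Bochner_Integration.integrable_add integrable_mult_right int xy)+
      also have "\<dots> = (1 - t) * m x + t * m y"
        unfolding m_def using int xy by (subst Bochner_Integration.integral_add) auto
      finally show "m ((1 - t) *\<^sub>R x + t *\<^sub>R y) \<le> (1 - t) * m x + t * m y" by simp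
    qed simp
    then have cont: "continuous_on {0<..} m"
      by (rule convex_on_continuous[OF open_greaterThan])
    define l1 where "l1 = max l0 B"
    have "m l1 = (LINT x|M. 0)"
      unfolding m_def
      by (rule integral_cong_AE) (use e_meas bound in \<open>auto simp: e_def l1_def elim: AE_mp\<close>)
    then have "m l1 \<le> r" using \<open>0 < r\<close> by simp
    have "\<exists>l. l0 \<le> l \<and> l \<le> l1 \<and> m l = r"
      by (rule IVT2'[of m l1 r l0, OF \<open>m l1 \<le> r\<close> l0(2)])
         (use l0 in \<open>auto simp: l1_def intro: continuous_on_subset[OF cont]\<close>)
    then obtain l where "l0 \<le> l" "m l = r" by blast
    then have "0 < l" using l0 by simp
    then show ?thesis
      using that[of l] nn_m[of l] e_eq[of l] \<open>m l = r\<close> by simp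
  next
    case False
    then have "(\<integral>\<^sup>+ x. ennreal (max 0 (\<bar>v x\<bar> - l)) \<partial>M) \<le> ennreal r" if "0 < l" for l
      using nn_m[OF that] that unfolding e_def by (force intro: ennreal_leI)
    from nn_integral_abs_le_if_truncations_le[OF v this] show ?thesis
      using that[of 0] by (simp add: trunc_def)
  qed
qed

lemma L2_norm_mono:
  assumes "(\<integral>\<^sup>+ x. ennreal ((v x)\<^sup>2) \<partial>lebesgue) \<le> (\<integral>\<^sup>+ x. ennreal ((w x)\<^sup>2) \<partial>lebesgue)"
  shows "L2_norm v \<le> L2_norm w"
  using assms
  by (auto simp: L2_norm_def Let_def top_unique intro!: ennreal_leI enn2real_mono simp: less_top)

text \<open>
  With \<open>c\<close> the soft threshold of \<open>v\<close> at the level of \<open>soft_threshold_level\<close>, any \<open>b\<close> in the ball satisfies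
  \<open>\<integral>(v - c)\<^sup>2 + 2 l r = \<integral> h\<^sub>l(v) \<le> \<integral> h\<^sub>l(w) \<le> \<integral>(w - b)\<^sup>2 + 2 l r\<close>. So \<open>c\<close> is at least as good for \<open>v\<close> as
  any \<open>b\<close> is for \<open>w\<close>.
\<close>

lemma L2_dist_mono:
  fixes v w :: "'a::euclidean_space \<Rightarrow> real"
  assumes huber: "\<And>l. 0 \<le> l \<Longrightarrow>
      (\<integral>\<^sup>+ x. ennreal (huber l (v x)) \<partial>lebesgue) \<le> (\<integral>\<^sup>+ x. ennreal (huber l (w x)) \<partial>lebesgue)"
    and v: "v \<in> borel_measurable lebesgue" "AE x in lebesgue. \<bar>v x\<bar> \<le> B"
    and finite: "\<And>l. 0 < l \<Longrightarrow> (\<integral>\<^sup>+ x. ennreal (huber l (v x)) \<partial>lebesgue) < \<infinity>"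
    and w: "w \<in> borel_measurable lebesgue" and "0 < r"
  shows "L2_dist v (Q_ball r) \<le> L2_dist w (Q_ball r)"
proof -
  obtain l where l: "0 \<le> l" "(\<integral>\<^sup>+ x. ennreal \<bar>v x - trunc l (v x)\<bar> \<partial>lebesgue) \<le> ennreal r"
    "l = 0 \<or> (\<integral>\<^sup>+ x. ennreal \<bar>v x - trunc l (v x)\<bar> \<partial>lebesgue) = ennreal r"
    using soft_threshold_level[OF v finite \<open>0 < r\<close>] by metis
  define c where "c x = v x - trunc l (v x)" for x
  have c_meas: "c \<in> borel_measurable lebesgue"
    unfolding c_def
    using v(1) measurable_compose[OF v(1) borel_measurable_continuous_onI[OF continuous_trunc]]
    by (intro borel_measurable_diff)
  have "AE x in lebesgue. \<bar>c x\<bar> \<le> \<bar>B\<bar>"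
    using v(2) by eventually_elim (use l(1) in \<open>auto simp: c_def abs_minus_trunc\<close>)
  then have c_Q: "c \<in> Q_ball r"
    using c_meas l(2) unfolding Q_ball_def Linf_def by (auto simp: c_def)
  have c_mass: "ennreal (2 * l) * (\<integral>\<^sup>+ x. ennreal \<bar>c x\<bar> \<partial>lebesgue) = ennreal (2 * l) * ennreal r"
    using l(3) by (auto simp: c_def)
  have dual: "(\<integral>\<^sup>+ x. ennreal ((p x - b x)\<^sup>2 + 2 * l * \<bar>b x\<bar>) \<partial>lebesgue) =
      ennreal (2 * l) * (\<integral>\<^sup>+ x. ennreal \<bar>b x\<bar> \<partial>lebesgue) + (\<integral>\<^sup>+ x. ennreal ((p x - b x)\<^sup>2) \<partial>lebesgue)"
    if [measurable]: "p \<in> borel_measurable lebesgue" "b \<in> borel_measurable lebesgue" for p b :: "'a \<Rightarrow> real"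
  proof -
    have "(\<integral>\<^sup>+ x. ennreal ((p x - b x)\<^sup>2 + 2 * l * \<bar>b x\<bar>) \<partial>lebesgue) =
        (\<integral>\<^sup>+ x. ennreal (2 * l) * ennreal \<bar>b x\<bar> + ennreal ((p x - b x)\<^sup>2) \<partial>lebesgue)"
      using l(1) by (intro nn_integral_cong) (simp add: ennreal_mult[symmetric] add.commute flip: ennreal_plus)
    then show ?thesis by (simp add: nn_integral_add nn_integral_cmult)
  qed
  have "L2_norm (\<lambda>x. v x - c x) \<le> L2_norm (\<lambda>x. w x - b x)" if b: "b \<in> Q_ball r" for b
  proof (rule L2_norm_mono)
    have b_meas: "b \<in> borel_measurable lebesgue" and b_mass: "(\<integral>\<^sup>+ x. ennreal \<bar>b x\<bar> \<partial>lebesgue) \<le> ennreal r"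
      using b by (auto simp: Q_ball_def Linf_def)
    have "ennreal (2 * l) * ennreal r + (\<integral>\<^sup>+ x. ennreal ((v x - c x)\<^sup>2) \<partial>lebesgue) =
        (\<integral>\<^sup>+ x. ennreal (huber l (v x)) \<partial>lebesgue)"
      using dual[OF v(1) c_meas] c_mass huber_soft_threshold[OF l(1)] by (simp add: c_def)
    also have "\<dots> \<le> (\<integral>\<^sup>+ x. ennreal (huber l (w x)) \<partial>lebesgue)" by (rule huber[OF l(1)])
    also have "\<dots> \<le> (\<integral>\<^sup>+ x. ennreal ((w x - b x)\<^sup>2 + 2 * l * \<bar>b x\<bar>) \<partial>lebesgue)"
      by (intro nn_integral_mono ennreal_leI huber_le l(1))
    also have "\<dots> \<le> ennreal (2 * l) * ennreal r + (\<integral>\<^sup>+ x. ennreal ((w x - b x)\<^sup>2) \<partial>lebesgue)"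
      unfolding dual[OF w b_meas] by (intro add_right_mono mult_left_mono b_mass) simp
    finally show "(\<integral>\<^sup>+ x. ennreal ((v x - c x)\<^sup>2) \<partial>lebesgue) \<le> (\<integral>\<^sup>+ x. ennreal ((w x - b x)\<^sup>2) \<partial>lebesgue)"
      by (simp add: ennreal_add_left_cancel_le ennreal_mult_eq_top_iff)
  qed
  then show ?thesis
    unfolding L2_dist_def using c_Q by (intro INF_greatest INF_lower2)
qed

theorem theorem1p2:
  fixes f :: "real \<Rightarrow> real ^ 'd"
    and S :: "real \<Rightarrow> (real ^ 'd \<Rightarrow> real) \<Rightarrow> (real ^ 'd \<Rightarrow> real)"
    and a :: "real ^ 'd \<Rightarrow> real"
    and r :: real
  assumes "smooth f"
    and "kruzhkov_semigroup f S"
    and "r > 0"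
    and "a \<in> L2 \<inter> Linf lebesgue"
  shows "antimono_on {0..} (\<lambda>t. L2_dist (S t a) (Q_ball r))"
proof (rule monotone_onI)
  fix s t :: real assume "s \<in> {0..}" "t \<in> {0..}" "s \<le> t"
  then have st: "0 \<le> s" "s \<le> t" "0 \<le> t" by auto
  have sol: "kruzhkov_solution f a (\<lambda>t. S t a)"
    using assms(2,4) by (simp add: kruzhkov_semigroup_def)
  note decay = huber_decay[OF assms(1) sol]
  obtain B where B: "\<And>t. 0 \<le> t \<Longrightarrow> AE x in lebesgue. \<bar>S t a x\<bar> \<le> B"
    using kruzhkov_solution_bounded[OF sol] by metis
  have meas: "S \<tau> a \<in> borel_measurable lebesgue" if "0 \<le> \<tau>" for \<tau>
    using sol that by (simp add: kruzhkov_solution_def L1loc_measurable)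
  have a2: "(\<integral>\<^sup>+ x. ennreal ((a x)\<^sup>2) \<partial>lebesgue) < \<infinity>"
    using assms(4) by (auto simp: L2_def L2_norm_def Let_def less_top split: if_splits)
  have a0: "AE x in lebesgue. S 0 a x = a x" using sol by (simp add: kruzhkov_solution_def)
  \<comment> \<open>Square integrability of the initial datum makes the Huber integrals finite at time 0, hence at all times.\<close>
  have finite: "(\<integral>\<^sup>+ x. ennreal (huber l (S t a x)) \<partial>lebesgue) < \<infinity>" if "0 < l" for l
  proof -
    have "(\<integral>\<^sup>+ x. ennreal (huber l (S t a x)) \<partial>lebesgue) \<le> (\<integral>\<^sup>+ x. ennreal (huber l (S 0 a x)) \<partial>lebesgue)"
      using decay[of l 0 t] that st by simp
    also have "\<dots> \<le> (\<integral>\<^sup>+ x. ennreal ((a x)\<^sup>2) \<partial>lebesgue)"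
      using a0 by (intro nn_integral_mono_AE, eventually_elim)
        (use huber_le[of l _ 0] that in \<open>auto intro!: ennreal_leI\<close>)
    finally show ?thesis using a2 by (rule le_less_trans)
  qed
  show "L2_dist (S t a) (Q_ball r) \<le> L2_dist (S s a) (Q_ball r)"
    by (rule L2_dist_mono[OF _ meas[OF st(3)] B[OF st(3)] finite meas[OF st(1)] assms(3)])
       (use decay st in auto)
qed

end
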